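(* Let $p$ be a prime and let $G$ be a finite $p$-group such that $G_3\le \Phi(G')\cong C_p$ and $G/\Phi(G')\cong M_p(n,m,1)$, where $n\ge m$, and $n>1$ if $p=2$. Let $a,b\in G$ be elements whose images in $G/\Phi(G')$ are generators satisfying the defining presentation of $M_p(n,m,1)$ (so that the image of $a$ has order $p^n$ and the image of $b$ has order $p^m$), and put $c=[a,b]$. Then: (1) If $m=1$, then $p=2$, $[c,b]=c^2$ and $G$ has a unique $\mathcal{A}_1$-subgroup of index $p$. (2) If $m\ge 2$, then $I_{\min}=2$; that is, the minimal index in $G$ of an $\mathcal{A}_1$-subgroup of $G$ is $p^2$.
   Context: All groups are finite $p$-groups. $G'$ is the derived subgroup, $G_3=[G',G]$ is the third term of the lower central series, $\Phi(H)$ is the Frattini subgroup of $H$, and $[x,y]=x^{-1}y^{-1}xy$. An $\mathcal{A}_1$-group is a minimal non-abelian $p$-group (a non-abelian $p$-group all of whose proper subgroups are abelian). For a non-abelian $p$-group $G$, $p^{I_{\min}}$ denotes the minimal index in $G$ of the $\mathcal{A}_1$-subgroups of $G$. For $n\ge m\ge 1$ (with $n>1$ if $p=2$), $M_p(n,m,1)=\langle a,b,c\mid a^{p^n}=b^{p^m}=c^p=1,\ [a,b]=c,\ [c,a]=[c,b]=1\rangle$. *)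

theory Defs
  imports "HOL-Algebra.Algebra" "HOL-Computational_Algebra.Primes"
begin

section \<open>Groups given by generators and relations\<close>

text \<open>
  A word over the generators \<open>'x\<close> is a list of signed generators; \<open>(x, True)\<close> stands for
  \<open>x\<close> and \<open>(x, False)\<close> for its formal inverse.
\<close>

type_synonym 'x word = "('x \<times> bool) list"

definition inv_word :: "'x word \<Rightarrow> 'x word" where
  "inv_word w = rev (map (\<lambda>(x, s). (x, \<not> s)) w)"

definition comm_word :: "'x word \<Rightarrow> 'x word \<Rightarrow> 'x word" where
  "comm_word u v = inv_word u @ inv_word v @ u @ v"

text \<open>
  The congruence on words generated by free cancellation and by the relations \<open>R\<close>, a pair
  \<open>(u, v)\<close> in \<open>R\<close> being read as the relation \<open>u = v\<close>.  The words modulo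
  this congruence form the group presented by \<open>R\<close>.
\<close>

inductive word_eq :: "('x word \<times> 'x word) set \<Rightarrow> 'x word \<Rightarrow> 'x word \<Rightarrow> bool"
  for R :: "('x word \<times> 'x word) set"
where
  refl: "word_eq R w w"
| sym: "word_eq R u v \<Longrightarrow> word_eq R v u"
| trans: "word_eq R u v \<Longrightarrow> word_eq R v w \<Longrightarrow> word_eq R u w"
| congr: "word_eq R u v \<Longrightarrow> word_eq R (s @ u @ t) (s @ v @ t)"
| cancel: "word_eq R [(x, s), (x, \<not> s)] []"
| rel: "(u, v) \<in> R \<Longrightarrow> word_eq R u v"

definition word_rel :: "('x word \<times> 'x word) set \<Rightarrow> ('x word \<times> 'x word) set" where
  "word_rel R = {(u, v). word_eq R u v}"

definition presented_group :: "('x word \<times> 'x word) set \<Rightarrow> 'x word set monoid" where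
  "presented_group R =
     \<lparr>carrier = UNIV // word_rel R,
      monoid.mult = (\<lambda>U V. \<Union>u\<in>U. \<Union>v\<in>V. word_rel R `` {u @ v}),
      one = word_rel R `` {[]}\<rparr>"

definition word_value :: "('a, 'b) monoid_scheme \<Rightarrow> ('x \<Rightarrow> 'a) \<Rightarrow> 'x word \<Rightarrow> 'a" where
  "word_value G f w =
     foldr (\<lambda>(x, s) y. (if s then f x else inv\<^bsub>G\<^esub> f x) \<otimes>\<^bsub>G\<^esub> y) w \<one>\<^bsub>G\<^esub>"

definition satisfies_relations ::
  "('a, 'b) monoid_scheme \<Rightarrow> ('x \<Rightarrow> 'a) \<Rightarrow> ('x word \<times> 'x word) set \<Rightarrow> bool" where
  "satisfies_relations G f R \<longleftrightarrow> (\<forall>(u, v) \<in> R. word_value G f u = word_value G f v)"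

lemma equiv_word_rel: "equiv UNIV (word_rel R)"
proof (rule equivI)
  show "refl (word_rel R)" by (auto simp: word_rel_def refl_on_def intro: word_eq.refl)
  show "sym (word_rel R)" by (auto simp: word_rel_def sym_def dest: word_eq.sym)
  show "trans (word_rel R)"
    unfolding word_rel_def trans_def by (blast intro: word_eq.trans)
qed (simp add: word_rel_def)

lemma word_eq_append:
  assumes "word_eq R u u'" "word_eq R v v'"
  shows "word_eq R (u @ v) (u' @ v')"
proof -
  have "word_eq R (u @ v) (u' @ v)" using word_eq.congr[OF assms(1), of "[]" v] by simp
  moreover have "word_eq R (u' @ v) (u' @ v')" using word_eq.congr[OF assms(2), of u' "[]"] by simp
  ultimately show ?thesis by (rule word_eq.trans)
qed

lemma word_eq_inv_word: "word_eq R (inv_word w @ w) []"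
proof (induction w)
  case Nil
  then show ?case by (simp add: inv_word_def word_eq.refl)
next
  case (Cons a w)
  obtain x s where a: "a = (x, s)" by (cases a)
  have "word_eq R (inv_word w @ [(x, \<not> s), (x, \<not> \<not> s)] @ w) (inv_word w @ [] @ w)"
    by (intro word_eq.congr word_eq.cancel)
  then have "word_eq R (inv_word (a # w) @ a # w) (inv_word w @ w)"
    by (simp add: a inv_word_def)
  then show ?case using Cons by (rule word_eq.trans)
qed

lemma presented_group_mult:
  "word_rel R `` {u} \<otimes>\<^bsub>presented_group R\<^esub> word_rel R `` {v} = word_rel R `` {u @ v}"
proof -
  have "word_rel R `` {u' @ v'} = word_rel R `` {u @ v}"
    if "u' \<in> word_rel R `` {u}" "v' \<in> word_rel R `` {v}" for u' v'
  proof (rule equiv_class_eq[OF equiv_word_rel])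
    have "word_eq R (u @ v) (u' @ v')"
      using that by (intro word_eq_append) (simp_all add: word_rel_def)
    then show "(u' @ v', u @ v) \<in> word_rel R"
      by (simp add: word_rel_def word_eq.sym)
  qed
  moreover have "u \<in> word_rel R `` {u}" "v \<in> word_rel R `` {v}"
    by (simp_all add: word_rel_def word_eq.refl)
  ultimately have "(\<Union>u'\<in>word_rel R `` {u}. \<Union>v'\<in>word_rel R `` {v}. word_rel R `` {u' @ v'})
      = word_rel R `` {u @ v}" by blast
  then show ?thesis by (simp add: presented_group_def)
qed

lemma group_presented_group: "group (presented_group R)"
proof (rule groupI)
  let ?P = "presented_group R"
  have car: "U \<in> carrier ?P \<longleftrightarrow> (\<exists>u. U = word_rel R `` {u})" for U
    by (auto simp: presented_group_def quotient_def)
  have one: "\<one>\<^bsub>?P\<^esub> = word_rel R `` {[]}" by (simp add: presented_group_def)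
  show "\<one>\<^bsub>?P\<^esub> \<in> carrier ?P" unfolding car one by blast
  fix U assume "U \<in> carrier ?P"
  then obtain u where U: "U = word_rel R `` {u}" using car by blast
  show "\<one>\<^bsub>?P\<^esub> \<otimes>\<^bsub>?P\<^esub> U = U" by (simp add: one U presented_group_mult)
  have "word_rel R `` {inv_word u @ u} = word_rel R `` {[]}"
    by (intro equiv_class_eq[OF equiv_word_rel]) (simp add: word_rel_def word_eq_inv_word)
  then show "\<exists>V\<in>carrier ?P. V \<otimes>\<^bsub>?P\<^esub> U = \<one>\<^bsub>?P\<^esub>"
    using car by (intro bexI[of _ "word_rel R `` {inv_word u}"]) (auto simp: one U presented_group_mult)
  fix V assume "V \<in> carrier ?P"
  then obtain v where V: "V = word_rel R `` {v}" using car by blast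
  show "U \<otimes>\<^bsub>?P\<^esub> V \<in> carrier ?P" unfolding car U V presented_group_mult by blast
  fix W assume "W \<in> carrier ?P"
  then obtain w where W: "W = word_rel R `` {w}" using car by blast
  show "U \<otimes>\<^bsub>?P\<^esub> V \<otimes>\<^bsub>?P\<^esub> W = U \<otimes>\<^bsub>?P\<^esub> (V \<otimes>\<^bsub>?P\<^esub> W)"
    by (simp add: U V W presented_group_mult)
qed

section \<open>The groups $M_p(n,m,1)$\<close>

datatype gen = GenA | GenB | GenC

definition Mp_relations :: "nat \<Rightarrow> nat \<Rightarrow> nat \<Rightarrow> (gen word \<times> gen word) set" where
  "Mp_relations p n m =
     (let a = (GenA, True); b = (GenB, True); c = (GenC, True) in
      {(replicate (p ^ n) a, []), (replicate (p ^ m) b, []), (replicate p c, []),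
       (comm_word [a] [b], [c]), (comm_word [c] [a], []), (comm_word [c] [b], [])})"

definition Mp :: "nat \<Rightarrow> nat \<Rightarrow> nat \<Rightarrow> gen word set monoid" where
  "Mp p n m = presented_group (Mp_relations p n m)"

section \<open>Commutators, Frattini subgroup, minimal non-abelian subgroups\<close>

text \<open>
  The library's \<open>derived\<close> uses commutators $x y x^{-1} y^{-1}$, i.e. those below for
  $x^{-1}, y^{-1}$; the derived subgroup is the same for both conventions.
\<close>

definition commutator :: "('a, 'b) monoid_scheme \<Rightarrow> 'a \<Rightarrow> 'a \<Rightarrow> 'a" where
  "commutator G x y = inv\<^bsub>G\<^esub> x \<otimes>\<^bsub>G\<^esub> inv\<^bsub>G\<^esub> y \<otimes>\<^bsub>G\<^esub> x \<otimes>\<^bsub>G\<^esub> y"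

definition commutator_subgroup ::
  "('a, 'b) monoid_scheme \<Rightarrow> 'a set \<Rightarrow> 'a set \<Rightarrow> 'a set" where
  "commutator_subgroup G H K = generate G {commutator G h k | h k. h \<in> H \<and> k \<in> K}"

definition derived_subgroup :: "('a, 'b) monoid_scheme \<Rightarrow> 'a set" where
  "derived_subgroup G = derived G (carrier G)"

definition lower_central_3 :: "('a, 'b) monoid_scheme \<Rightarrow> 'a set" where
  "lower_central_3 G = commutator_subgroup G (derived_subgroup G) (carrier G)"

definition maximal_subgroup :: "'a set \<Rightarrow> ('a, 'b) monoid_scheme \<Rightarrow> bool" where
  "maximal_subgroup M G \<longleftrightarrow>
     subgroup M G \<and> M \<noteq> carrier G \<and>
     (\<forall>H. subgroup H G \<and> M \<subseteq> H \<longrightarrow> H = M \<or> H = carrier G)"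

text \<open>A group without maximal subgroups is its own Frattini subgroup.\<close>

definition frattini :: "('a, 'b) monoid_scheme \<Rightarrow> 'a set" where
  "frattini G = carrier G \<inter> \<Inter> {M. maximal_subgroup M G}"

definition finite_p_group :: "nat \<Rightarrow> ('a, 'b) monoid_scheme \<Rightarrow> bool" where
  "finite_p_group p G \<longleftrightarrow> group G \<and> (\<exists>k. order G = p ^ k)"

definition A1_group :: "nat \<Rightarrow> ('a, 'b) monoid_scheme \<Rightarrow> bool" where
  "A1_group p G \<longleftrightarrow>
     finite_p_group p G \<and> \<not> comm_group G \<and>
     (\<forall>H. subgroup H G \<and> H \<noteq> carrier G \<longrightarrow> comm_group (G\<lparr>carrier := H\<rparr>))"

definition A1_subgroup :: "nat \<Rightarrow> 'a set \<Rightarrow> ('a, 'b) monoid_scheme \<Rightarrow> bool" where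
  "A1_subgroup p H G \<longleftrightarrow> subgroup H G \<and> A1_group p (G\<lparr>carrier := H\<rparr>)"

definition subgroup_index :: "('a, 'b) monoid_scheme \<Rightarrow> 'a set \<Rightarrow> nat" where
  "subgroup_index G H = card (rcosets\<^bsub>G\<^esub> H)"

text \<open>
  Both of the following are meaningful only if \<open>G\<close> has an $\mathcal{A}_1$-subgroup, which is
  the case for every non-abelian finite $p$-group.
\<close>

definition min_A1_index :: "nat \<Rightarrow> ('a, 'b) monoid_scheme \<Rightarrow> nat" where
  "min_A1_index p G = (LEAST i. \<exists>H. A1_subgroup p H G \<and> subgroup_index G H = i)"

definition I_min :: "nat \<Rightarrow> ('a, 'b) monoid_scheme \<Rightarrow> nat" where
  "I_min p G = (THE k. p ^ k = min_A1_index p G)"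

end

theory Submission
  imports Defs
begin

text \<open>
  The group $P = \Phi(G')$ is central of order $p$, and $G'$ is cyclic of order $p^2$, generated by
  $c$. Hence two elements $x$, $y$ of $G$ with $[x,y] \in P \setminus \{1\}$ generate an
  $\mathcal{A}_1$-subgroup. If $m \ge 2$, then $\langle x, y^p\rangle$ is such a subgroup, of index at
  most $p^2$, for one of the pairs $(a,b)$, $(b,a)$, $(a,ab)$, because
  $[x,y^p] = [x,y]^p [x,y,y]^{p \choose 2}$. A subgroup of index $p$ is not an $\mathcal{A}_1$-group:
  its image in the $\mathcal{A}_1$-group $G/P$ is abelian and contains the elementary abelian group of
  order $p^3$ generated by $a^{p^{n-1}}$, $b^{p^{m-1}}$ and $c$, so it is not generated by two elements.
  If $m = 1$, then $b^p$ is central and $1 = [a,b^p]$ forces $p = 2$ and $[c,b] = c^2$; the last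
  argument excludes the maximal subgroup containing $b$, and exactly one of $a$, $ab$ commutes with $c$.
\<close>

text \<open>The relations of M_p(n,m,1) alone bound its order only from above, so they do not
  exclude that c falls into P or that the three elements of order p in G/P are dependent. A
  Heisenberg model supplies the lower bound p^(n+m+1); then the normal forms b^j a^i c^k in G/P are
  unique by counting. P is central because it is normal of order p in a p-group. If c^p were 1, then
  <c> would be a maximal subgroup of G' avoiding P, although the Frattini subgroup lies in every
  maximal subgroup; hence c^p generates P.

  The obstacle is the binomial term of [x,y^p]. For odd p it vanishes, because p divides p choose 2.
  For p = 2 it is [x,y,y], and it may cancel [x,y]^2 because P has a single non-trivial element. So
  y has to be chosen among b, a, ab such that it commutes with c, and such a choice exists because
  [c,ab] is the product of [c,a] and [c,b]. The group G itself must also be ruled out as an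
  A1-subgroup; the subgroup found in this way does that, being proper and non-abelian.\<close>

lemma pow_pigeonhole:
  assumes "finite S" "card S < p" "\<And>i. i < p \<Longrightarrow> f i \<in> S"
  obtains i d :: nat where "0 < d" "d < p" "f i = f (i + d)"
proof -
  have "card (f ` {..<p}) < card {..<p}"
    using assms card_mono[of S "f ` {..<p}"] by (simp add: image_subset_iff)
  then obtain i j where ij: "i < p" "j < p" "i \<noteq> j" "f i = f j"
    using pigeonhole[of f "{..<p}"] unfolding inj_on_def by auto
  show thesis
  proof (cases "i < j")
    case True then show thesis using that[of "j - i" i] ij by simp
  next
    case False then show thesis using that[of "i - j" j] ij by simp
  qed
qed

section \<open>A lower bound for the order of $M_p(n,m,1)$\<close>

text \<open>
  The triple $(i,j,k)$ stands for $b^j a^i c^k$ in the integral Heisenberg group; its coordinates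
  modulo $p^n$, $p^m$, $p$ are invariants of words of $M_p(n,m,1)$.
\<close>

fun heis_mult :: "int \<times> int \<times> int \<Rightarrow> int \<times> int \<times> int \<Rightarrow> int \<times> int \<times> int" where
  "heis_mult (i, j, k) (r, s, l) = (i + r, j + s, k + l + i * s)"

fun heis_letter :: "gen \<times> bool \<Rightarrow> int \<times> int \<times> int" where
  "heis_letter (GenA, s) = (if s then 1 else -1, 0, 0)"
| "heis_letter (GenB, s) = (0, if s then 1 else -1, 0)"
| "heis_letter (GenC, s) = (0, 0, if s then 1 else -1)"

definition heis_value :: "gen word \<Rightarrow> int \<times> int \<times> int" where
  "heis_value w = foldr (\<lambda>x. heis_mult (heis_letter x)) w (0, 0, 0)"

fun heis_cong :: "nat \<Rightarrow> nat \<Rightarrow> nat \<Rightarrow> int \<times> int \<times> int \<Rightarrow> int \<times> int \<times> int \<Rightarrow> bool" where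
  "heis_cong p n m (i, j, k) (r, s, l) \<longleftrightarrow>
     int p ^ n dvd i - r \<and> int p ^ m dvd j - s \<and> int p dvd k - l"

lemma heis_mult_assoc: "heis_mult (heis_mult x y) z = heis_mult x (heis_mult y z)"
  by (cases x; cases y; cases z) (simp add: algebra_simps)

lemma heis_mult_zero [simp]: "heis_mult (0, 0, 0) x = x" "heis_mult x (0, 0, 0) = x"
  by (cases x; simp)+

lemma heis_value_simps [simp]:
  "heis_value [] = (0, 0, 0)"
  "heis_value (x # w) = heis_mult (heis_letter x) (heis_value w)"
  by (simp_all add: heis_value_def)

lemma heis_value_append: "heis_value (u @ v) = heis_mult (heis_value u) (heis_value v)"
  by (induction u) (simp_all add: heis_mult_assoc)

lemma heis_value_replicate:
  "heis_value (replicate N (GenA, True)) = (int N, 0, 0)"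
  "heis_value (replicate N (GenB, True)) = (0, int N, 0)"
  "heis_value (replicate N (GenC, True)) = (0, 0, int N)"
  by (induction N) simp_all

text \<open>The summand i s is well defined modulo p because p divides both p^n and p^m, which is
  what n, m \<ge> 1 provides; the change of i s is split into (i - i') s and i' (s - s').\<close>

lemma heis_cong_mult:
  assumes "1 \<le> n" "1 \<le> m" "heis_cong p n m x x'" "heis_cong p n m y y'"
  shows "heis_cong p n m (heis_mult x y) (heis_mult x' y')"
proof -
  obtain i j k where x: "x = (i, j, k)" by (cases x)
  obtain i' j' k' where x': "x' = (i', j', k')" by (cases x')
  obtain r s l where y: "y = (r, s, l)" by (cases y)
  obtain r' s' l' where y': "y' = (r', s', l')" by (cases y')
  have d: "int p ^ n dvd i - i'" "int p ^ m dvd j - j'" "int p dvd k - k'"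
    "int p ^ n dvd r - r'" "int p ^ m dvd s - s'" "int p dvd l - l'"
    using assms(3,4) by (simp_all add: x x' y y')
  have "int p dvd int p ^ n" "int p dvd int p ^ m" using assms(1,2) by (simp_all add: dvd_power)
  then have "int p dvd i - i'" "int p dvd s - s'" using d dvd_trans by blast+
  then have "int p dvd (k - k') + (l - l') + ((i - i') * s + i' * (s - s'))"
    using d by (intro dvd_add dvd_mult[of _ "s - s'"] dvd_mult2[of _ "i - i'"])
  also have "(k - k') + (l - l') + ((i - i') * s + i' * (s - s')) = k + l + i * s - (k' + l' + i' * s')"
    by (simp add: algebra_simps)
  finally have "int p dvd k + l + i * s - (k' + l' + i' * s')" .
  moreover have "int p ^ n dvd (i - i') + (r - r')" "int p ^ m dvd (j - j') + (s - s')"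
    using d by (intro dvd_add; simp)+
  ultimately show ?thesis by (simp add: x x' y y' algebra_simps)
qed

lemma heis_cong_refl: "heis_cong p n m x x"
  by (cases x) simp

lemma heis_cong_sym: "heis_cong p n m x y \<Longrightarrow> heis_cong p n m y x"
  by (cases x; cases y) (auto simp: dvd_diff_commute)

lemma heis_cong_trans: "heis_cong p n m x y \<Longrightarrow> heis_cong p n m y z \<Longrightarrow> heis_cong p n m x z"
proof (cases x; cases y; cases z)
  fix i j k r s l e f g
  assume "heis_cong p n m x y" "heis_cong p n m y z"
    and "x = (i, j, k)" "y = (r, s, l)" "z = (e, f, g)"
  then show ?thesis
    using dvd_add[of "int p ^ n" "i - r" "r - e"] dvd_add[of "int p ^ m" "j - s" "s - f"]
      dvd_add[of "int p" "k - l" "l - g"] by simp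
qed

text \<open>Since \<open>heis_cong\<close> respects the Heisenberg product, it remains to evaluate
  free cancellation and the six defining relations.\<close>

lemma word_eq_heis_cong:
  assumes nm: "1 \<le> n" "1 \<le> m" and "word_eq (Mp_relations p n m) u v"
  shows "heis_cong p n m (heis_value u) (heis_value v)"
  using assms(3)
proof (induction rule: word_eq.induct)
  case (refl w) then show ?case by (rule heis_cong_refl)
next
  case (sym u v) then show ?case by (blast intro: heis_cong_sym)
next
  case (trans u v w) then show ?case by (blast intro: heis_cong_trans)
next
  case (congr u v s t)
  then show ?case unfolding heis_value_append by (intro heis_cong_mult nm heis_cong_refl)
next
  case (cancel x s)
  then show ?case by (cases x) auto
next
  case (rel u v)
  then show ?case
    by (auto simp: Mp_relations_def Let_def heis_value_replicate comm_word_def inv_word_def)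
qed

text \<open>Words b^j a^i c^k with reduced exponents have pairwise incongruent values, so they lie
  in distinct classes. Finiteness is assumed because \<open>order\<close> is 0 on an infinite
  carrier; it will come from the isomorphism with G/P.\<close>

lemma order_Mp_ge:
  assumes p: "p > 0" and nm: "1 \<le> n" "1 \<le> m" and fin: "finite (carrier (Mp p n m))"
  shows "p ^ (n + m + 1) \<le> order (Mp p n m)"
proof -
  let ?R = "Mp_relations p n m"
  let ?w = "\<lambda>(i, j, k). replicate j (GenB, True) @ replicate i (GenA, True) @ replicate k (GenC, True)"
  let ?f = "\<lambda>x. word_rel ?R `` {?w x}"
  let ?B = "{..<p ^ n} \<times> {..<p ^ m} \<times> {..<p}"
  have eqI: "i = r" if "i < N" "r < N" "int N dvd int i - int r" for i r N :: nat
    using that by (metis mod_eq_dvd_iff mod_less of_nat_eq_iff zmod_int)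
  have "inj_on ?f ?B"
  proof (rule inj_onI)
    fix x y assume B: "x \<in> ?B" "y \<in> ?B" and f: "?f x = ?f y"
    obtain i j k r s l where xy: "x = (i, j, k)" "y = (r, s, l)" by (cases x; cases y)
    have *: "i < p ^ n" "j < p ^ m" "k < p" "r < p ^ n" "s < p ^ m" "l < p"
      using B by (simp_all add: xy)
    have eq: "?f (i, j, k) = ?f (r, s, l)" using f by (simp only: xy)
    have "(?w (i, j, k), ?w (r, s, l)) \<in> word_rel ?R"
      by (rule eq_equiv_class[OF eq equiv_word_rel]) simp
    then have "word_eq ?R (?w (i, j, k)) (?w (r, s, l))" by (simp add: word_rel_def)
    then have "heis_cong p n m (heis_value (?w (i, j, k))) (heis_value (?w (r, s, l)))"
      by (rule word_eq_heis_cong[OF nm])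
    then have "int (p ^ n) dvd int i - int r" "int (p ^ m) dvd int j - int s" "int p dvd int k - int l"
      by (simp_all add: heis_value_append heis_value_replicate)
    then show "x = y" using * eqI by (simp add: xy)
  qed
  moreover have "?f ` ?B \<subseteq> carrier (Mp p n m)"
    by (auto simp: Mp_def presented_group_def quotient_def)
  ultimately have "card ?B \<le> card (carrier (Mp p n m))"
    using fin card_inj_on_le by blast
  then show ?thesis by (simp add: order_def card_cartesian_product power_add mult_ac)
qed

section \<open>Groups and $p$-groups\<close>

context group
begin

section \<open>Powers with exponent coprime to the order\<close>

lemma subgroup_nat_pow_closed: "subgroup H G \<Longrightarrow> h \<in> H \<Longrightarrow> h [^] (k::nat) \<in> H"
  using subgroup_int_pow_closed[of H h "int k"] by (simp add: int_pow_int)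

lemma nat_pow_mod_split:
  "x \<in> carrier G \<Longrightarrow> x [^] (k::nat) = x [^] (k mod N) \<otimes> (x [^] N) [^] (k div N)"
  by (simp add: nat_pow_pow nat_pow_mult)

text \<open>By Bezout, d is invertible modulo the order of G, so x is a power of x^d. The exponent
  is an integer because it will be a determinant.\<close>

lemma int_pow_coprime_mem:
  assumes H: "subgroup H G" and x: "x \<in> carrier G"
    and d: "coprime d (int (order G))" and xd: "x [^] d \<in> H"
  shows "x \<in> H"
proof -
  obtain u v where "u * d + v * int (order G) = 1"
    using bezout_int[of d "int (order G)"] d by auto
  then have uv: "d * u = 1 + int (order G) * (- v)"
    by (simp add: algebra_simps)
  have "(x [^] d) [^] u \<in> H"
    using subgroup_int_pow_closed[OF H xd] .
  moreover have "(x [^] d) [^] u = x [^] (1::int) \<otimes> (x [^] int (order G)) [^] (- v)"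
    using x by (simp only: int_pow_pow uv int_pow_mult)
  moreover have "x [^] int (order G) = \<one>"
    using x pow_order_eq_1 by (simp add: int_pow_int)
  ultimately show ?thesis using x by simp
qed

lemma order_prime_power_coprime:
  assumes "order G = p ^ e" "Factorial_Ring.prime p" "\<not> int p dvd d"
  shows "coprime d (int (order G))"
proof -
  have "coprime (int p) d" using assms by (intro prime_imp_coprime) simp_all
  then show ?thesis using assms(1) by (simp add: coprime_commute)
qed

lemma int_pow_eq_one_of_dvd:
  assumes "x \<in> carrier G" "x [^] (p::nat) = \<one>" "int p dvd d"
  shows "x [^] d = \<one>"
proof -
  obtain k where "d = int p * k" using assms(3) by blast
  then show ?thesis using assms(1,2) by (simp add: int_pow_pow[symmetric] int_pow_int)
qed

section \<open>Central elements and the normal form y^j x^i t^k\<close>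

definition central_elem :: "'a \<Rightarrow> bool" where
  "central_elem t \<longleftrightarrow> t \<in> carrier G \<and> (\<forall>g\<in>carrier G. t \<otimes> g = g \<otimes> t)"

lemma central_elem_closed: "central_elem t \<Longrightarrow> t \<in> carrier G"
  by (simp add: central_elem_def)

lemma central_elem_comm: "central_elem t \<Longrightarrow> g \<in> carrier G \<Longrightarrow> t \<otimes> g = g \<otimes> t"
  by (simp add: central_elem_def)

lemma central_elem_mult:
  assumes "central_elem s" "central_elem t" shows "central_elem (s \<otimes> t)"
  unfolding central_elem_def
proof (intro conjI ballI)
  show "s \<otimes> t \<in> carrier G" using assms by (simp add: central_elem_closed)
  fix g assume g: "g \<in> carrier G"
  note [simp] = g central_elem_closed[OF assms(1)] central_elem_closed[OF assms(2)]
  have "s \<otimes> t \<otimes> g = s \<otimes> (g \<otimes> t)"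
    by (simp add: m_assoc central_elem_comm[OF assms(2) g])
  also have "\<dots> = s \<otimes> g \<otimes> t" by (simp add: m_assoc)
  also have "\<dots> = g \<otimes> s \<otimes> t" by (simp only: central_elem_comm[OF assms(1) g])
  also have "\<dots> = g \<otimes> (s \<otimes> t)" by (simp add: m_assoc)
  finally show "s \<otimes> t \<otimes> g = g \<otimes> (s \<otimes> t)" .
qed

lemma central_elem_inv:
  assumes "central_elem t" shows "central_elem (inv t)"
  unfolding central_elem_def
proof (intro conjI ballI)
  show "inv t \<in> carrier G" using assms by (simp add: central_elem_closed)
  fix g assume g: "g \<in> carrier G"
  note [simp] = g central_elem_closed[OF assms]
  have "inv (t \<otimes> inv g) = inv (inv g \<otimes> t)"
    using central_elem_comm[OF assms, of "inv g"] by simp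
  then show "inv t \<otimes> g = g \<otimes> inv t" by (simp add: inv_mult_group)
qed

lemma central_elem_pow:
  assumes "central_elem t" shows "central_elem (t [^] (k::nat))"
proof (induction k)
  case 0 then show ?case by (simp add: central_elem_def)
next
  case (Suc k) then show ?case using assms by (simp add: central_elem_mult)
qed

lemma mult_pow_of_mult:
  assumes x: "x \<in> carrier G" and y: "y \<in> carrier G" and t: "central_elem t"
    and xy: "x \<otimes> y = y \<otimes> x \<otimes> t"
  shows "x \<otimes> y [^] (j::nat) = y [^] j \<otimes> x \<otimes> t [^] j"
proof (induction j)
  case 0 then show ?case using x by simp
next
  case (Suc j)
  note [simp] = x y central_elem_closed[OF t]
  have tj: "central_elem (t [^] j)" using central_elem_pow[OF t] .
  have "x \<otimes> y [^] Suc j = y [^] j \<otimes> x \<otimes> t [^] j \<otimes> y"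
    by (simp add: m_assoc[symmetric] Suc)
  also have "\<dots> = y [^] j \<otimes> (x \<otimes> y) \<otimes> t [^] j"
    using central_elem_comm[OF tj y] by (simp add: m_assoc)
  also have "\<dots> = (y [^] j \<otimes> y) \<otimes> x \<otimes> (t \<otimes> t [^] j)"
    by (simp add: xy m_assoc)
  also have "\<dots> = y [^] Suc j \<otimes> x \<otimes> t [^] Suc j"
    by (simp only: nat_pow_Suc2[OF central_elem_closed[OF t]] nat_pow_Suc[of y])
  finally show ?case .
qed

lemma pow_mult_pow_of_mult:
  assumes x: "x \<in> carrier G" and y: "y \<in> carrier G" and t: "central_elem t"
    and xy: "x \<otimes> y = y \<otimes> x \<otimes> t"
  shows "x [^] (i::nat) \<otimes> y [^] (j::nat) = y [^] j \<otimes> x [^] i \<otimes> t [^] (i * j)"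
proof (induction i)
  case 0 then show ?case using y by simp
next
  case (Suc i)
  note [simp] = x y central_elem_closed[OF t]
  have "x [^] Suc i \<otimes> y [^] j = x \<otimes> (x [^] i \<otimes> y [^] j)"
    by (simp only: nat_pow_Suc2[OF x] m_assoc x y nat_pow_closed)
  also have "\<dots> = (x \<otimes> y [^] j) \<otimes> x [^] i \<otimes> t [^] (i * j)"
    by (simp add: Suc m_assoc)
  also have "\<dots> = y [^] j \<otimes> x \<otimes> (t [^] j \<otimes> x [^] i) \<otimes> t [^] (i * j)"
    using mult_pow_of_mult[OF x y t xy] by (simp add: m_assoc)
  also have "t [^] j \<otimes> x [^] i = x [^] i \<otimes> t [^] j"
    using central_elem_comm[OF central_elem_pow[OF t]] by simp
  also have "y [^] j \<otimes> x \<otimes> (x [^] i \<otimes> t [^] j) \<otimes> t [^] (i * j)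
     = y [^] j \<otimes> (x \<otimes> x [^] i) \<otimes> (t [^] j \<otimes> t [^] (i * j))"
    by (simp add: m_assoc)
  also have "\<dots> = y [^] j \<otimes> x [^] Suc i \<otimes> t [^] (Suc i * j)"
    by (simp only: nat_pow_Suc2[OF x] nat_pow_mult[OF central_elem_closed[OF t]] mult_Suc)
  finally show ?case .
qed

text \<open>This is the product of \<open>heis_mult\<close> with y, x, t in the roles of b, a, c:
  moving x^i past y^s produces t^(i s).\<close>

lemma normal_form_mult:
  fixes i j k r s l :: nat
  assumes x: "x \<in> carrier G" and y: "y \<in> carrier G" and t: "central_elem t"
    and xy: "x \<otimes> y = y \<otimes> x \<otimes> t"
  shows "(y [^] j \<otimes> x [^] i \<otimes> t [^] k) \<otimes> (y [^] s \<otimes> x [^] r \<otimes> t [^] l)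
    = y [^] (j + s) \<otimes> x [^] (i + r) \<otimes> t [^] (k + l + i * s)"
proof -
  note [simp] = x y central_elem_closed[OF t]
  have c: "t [^] (k::nat) \<otimes> g = g \<otimes> t [^] k" if "g \<in> carrier G" for g k
    using central_elem_comm[OF central_elem_pow[OF t] that] .
  have "(y [^] j \<otimes> x [^] i \<otimes> t [^] k) \<otimes> (y [^] s \<otimes> x [^] r \<otimes> t [^] l)
    = y [^] j \<otimes> x [^] i \<otimes> (t [^] k \<otimes> (y [^] s \<otimes> x [^] r)) \<otimes> t [^] l"
    by (simp add: m_assoc)
  also have "\<dots> = y [^] j \<otimes> x [^] i \<otimes> ((y [^] s \<otimes> x [^] r) \<otimes> t [^] k) \<otimes> t [^] l"
    by (subst c) simp_all
  also have "\<dots> = y [^] j \<otimes> (x [^] i \<otimes> y [^] s) \<otimes> x [^] r \<otimes> t [^] k \<otimes> t [^] l"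
    by (simp add: m_assoc)
  also have "\<dots> = y [^] j \<otimes> y [^] s \<otimes> x [^] i \<otimes> (t [^] (i * s) \<otimes> x [^] r) \<otimes> t [^] k \<otimes> t [^] l"
    by (simp add: pow_mult_pow_of_mult[OF x y t xy] m_assoc)
  also have "\<dots> = y [^] j \<otimes> y [^] s \<otimes> x [^] i \<otimes> (x [^] r \<otimes> t [^] (i * s)) \<otimes> t [^] k \<otimes> t [^] l"
    by (subst c) simp_all
  also have "\<dots> = (y [^] j \<otimes> y [^] s) \<otimes> (x [^] i \<otimes> x [^] r) \<otimes> (t [^] (i * s) \<otimes> t [^] k \<otimes> t [^] l)"
    by (simp add: m_assoc)
  also have "\<dots> = y [^] (j + s) \<otimes> x [^] (i + r) \<otimes> t [^] (i * s + k + l)"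
    by (simp only: nat_pow_mult x y central_elem_closed[OF t])
  finally show ?thesis by (simp add: add_ac)
qed

text \<open>Only the exponents of y and x are recorded: in \<open>noncommuting_mem\<close>, t is
  already known to lie in the subgroup when powers are compared, so any power of t can be divided
  out.\<close>

lemma normal_form_pow:
  fixes i j k N :: nat
  assumes x: "x \<in> carrier G" and y: "y \<in> carrier G" and t: "central_elem t"
    and xy: "x \<otimes> y = y \<otimes> x \<otimes> t"
  shows "\<exists>l::nat. (y [^] j \<otimes> x [^] i \<otimes> t [^] k) [^] N = y [^] (j * N) \<otimes> x [^] (i * N) \<otimes> t [^] l"
proof (induction N)
  case 0 show ?case by (rule exI[of _ 0]) simp
next
  case (Suc N)
  then obtain l :: nat where "(y [^] j \<otimes> x [^] i \<otimes> t [^] k) [^] N = y [^] (j * N) \<otimes> x [^] (i * N) \<otimes> t [^] l"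
    by blast
  then show ?case
    by (auto simp: normal_form_mult[OF x y t xy] add.commute)
qed

lemma finite_mult_closed_subgroup:
  assumes fin: "finite (carrier G)" and S: "S \<subseteq> carrier G" "S \<noteq> {}"
    and cl: "\<And>g h. g \<in> S \<Longrightarrow> h \<in> S \<Longrightarrow> g \<otimes> h \<in> S"
  shows "subgroup S G"
proof (rule subgroupI)
  fix g assume g: "g \<in> S"
  have pow: "g [^] Suc k \<in> S" for k
    by (induction k) (use g S cl in \<open>auto\<close>)
  have ord: "order G > 0" using fin order_gt_0_iff_finite by blast
  have gc: "g \<in> carrier G" using g S by blast
  \<comment> \<open>The exponent 2|G| - 1, unlike |G| - 1, is positive even for the trivial group,
    so it has the form \<open>Suc k\<close> required by \<open>pow\<close>.\<close>
  have "g [^] (2 * order G - 1) \<otimes> g = g [^] Suc (2 * order G - 1)" by simp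
  also have "Suc (2 * order G - 1) = order G * 2" using ord by simp
  also have "g [^] (order G * 2) = \<one>"
    using gc pow_order_eq_1[OF gc] by (simp add: nat_pow_pow[symmetric])
  finally have "inv g = g [^] (2 * order G - 1)"
    using gc by (simp add: inv_equality)
  moreover have "2 * order G - 1 = Suc (2 * order G - 2)" using ord by simp
  ultimately show "inv g \<in> S" using pow by metis
qed (use S cl in auto)

lemma generate_normal_form:
  assumes fin: "finite (carrier G)"
    and x: "x \<in> carrier G" and y: "y \<in> carrier G" and t: "central_elem t"
    and xy: "x \<otimes> y = y \<otimes> x \<otimes> t" and g: "g \<in> generate G {x, y}"
  shows "\<exists>j i k. g = y [^] (j::nat) \<otimes> x [^] (i::nat) \<otimes> t [^] (k::nat)"
proof -
  let ?S = "{g. \<exists>j i k. g = y [^] (j::nat) \<otimes> x [^] (i::nat) \<otimes> t [^] (k::nat)}"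
  note [simp] = x y central_elem_closed[OF t]
  have "subgroup ?S G"
  proof (rule finite_mult_closed_subgroup[OF fin])
    fix g h assume "g \<in> ?S" "h \<in> ?S"
    then obtain j i k s r l :: nat where "g = y [^] j \<otimes> x [^] i \<otimes> t [^] k"
      "h = y [^] s \<otimes> x [^] r \<otimes> t [^] l" by blast
    then show "g \<otimes> h \<in> ?S" using normal_form_mult[OF x y t xy] by blast
  qed auto
  moreover have "y [^] (0::nat) \<otimes> x [^] (1::nat) \<otimes> t [^] (0::nat) \<in> ?S"
    "y [^] (1::nat) \<otimes> x [^] (0::nat) \<otimes> t [^] (0::nat) \<in> ?S" by blast+
  then have "{x, y} \<subseteq> ?S" by simp
  ultimately show ?thesis using generate_subgroup_incl g by blast
qed

text \<open>
  If \<open>u\<close> and \<open>v\<close> have exponents $(j,i)$ and $(s,r)$ in \<open>y\<close> and \<open>x\<close>, their commutator is $t^D$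
  for the determinant $D = is - rj$, and $x^D$ is a product of powers of \<open>u\<close>, \<open>v\<close> and \<open>t\<close>.
\<close>

lemma noncommuting_mem:
  assumes p: "Factorial_Ring.prime p" and ord: "order G = p ^ e"
    and x: "x \<in> carrier G" and y: "y \<in> carrier G" and t: "central_elem t"
    and xy: "x \<otimes> y = y \<otimes> x \<otimes> t" and tp: "t [^] p = \<one>"
    and H: "subgroup H G" "H \<subseteq> generate G {x, y}"
    and uv: "u \<in> H" "v \<in> H" "u \<otimes> v \<noteq> v \<otimes> u"
  shows "x \<in> H"
proof -
  have "order G > 0" using ord p by (simp add: prime_gt_0_nat)
  then have fin: "finite (carrier G)" using order_gt_0_iff_finite by blast
  note [simp] = x y central_elem_closed[OF t]
  obtain j i k :: nat where u: "u = y [^] j \<otimes> x [^] i \<otimes> t [^] k"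
    using generate_normal_form[OF fin x y t xy] uv(1) H(2) by blast
  obtain s r l :: nat where v: "v = y [^] s \<otimes> x [^] r \<otimes> t [^] l"
    using generate_normal_form[OF fin x y t xy] uv(2) H(2) by blast
  define D where "D = int (i * s) - int (r * j)"
  have ucl [simp]: "u \<in> carrier G" and vcl [simp]: "v \<in> carrier G" unfolding u v by simp_all
  have "u \<otimes> v = y [^] (j + s) \<otimes> x [^] (i + r) \<otimes> t [^] (k + l + i * s)"
    unfolding u v by (rule normal_form_mult[OF x y t xy])
  moreover have "v \<otimes> u = y [^] (j + s) \<otimes> x [^] (i + r) \<otimes> t [^] (k + l + r * j)"
    unfolding u v normal_form_mult[OF x y t xy] by (simp add: add.commute)
  moreover have "t [^] (k + l + i * s) = t [^] (k + l + r * j) \<otimes> t [^] D"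
  proof -
    have "int (k + l + i * s) = int (k + l + r * j) + D" by (simp add: D_def)
    then show ?thesis
      by (metis central_elem_closed int_pow_int int_pow_mult t)
  qed
  ultimately have uvD: "u \<otimes> v = v \<otimes> u \<otimes> t [^] D" by (simp add: m_assoc)
  have nd: "\<not> int p dvd D"
    using uv(3) uvD int_pow_eq_one_of_dvd[OF _ tp] by auto
  have cop: "coprime D (int (order G))"
    using order_prime_power_coprime[OF ord p nd] .
  have "t [^] D = inv w \<otimes> (w \<otimes> t [^] D)" if "w \<in> carrier G" for w
    using that by (simp add: m_assoc[symmetric])
  then have "t [^] D = inv (v \<otimes> u) \<otimes> (u \<otimes> v)"
    unfolding uvD by simp
  also have "\<dots> \<in> H" using uv H by (simp add: subgroup.m_closed subgroup.m_inv_closed)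
  finally have tH: "t \<in> H" using int_pow_coprime_mem[OF H(1) _ cop] by simp
  \<comment> \<open>The powers u^s and v^j have the same exponent of y, so their quotient is x^D up
    to powers of t.\<close>
  obtain e1 :: nat where e1: "u [^] s = y [^] (j * s) \<otimes> x [^] (i * s) \<otimes> t [^] e1"
    using normal_form_pow[OF x y t xy] unfolding u by blast
  obtain e2 :: nat where e2: "v [^] j = y [^] (j * s) \<otimes> x [^] (r * j) \<otimes> t [^] e2"
    using normal_form_pow[OF x y t xy, of s r l j] unfolding v by (auto simp: mult.commute)
  have "inv (v [^] j \<otimes> inv (t [^] e2)) \<otimes> (u [^] s \<otimes> inv (t [^] e1)) =
     inv (y [^] (j * s) \<otimes> x [^] (r * j)) \<otimes> (y [^] (j * s) \<otimes> x [^] (i * s))"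
    unfolding e1 e2 by (simp add: m_assoc)
  also have "\<dots> = inv (x [^] (r * j)) \<otimes> (inv (y [^] (j * s)) \<otimes> y [^] (j * s)) \<otimes> x [^] (i * s)"
    by (simp only: inv_mult_group m_assoc x y nat_pow_closed inv_closed m_closed)
  also have "\<dots> = inv (x [^] (r * j)) \<otimes> x [^] (i * s)" by simp
  also have "\<dots> = x [^] D"
  proof -
    have "D = - int (r * j) + int (i * s)" by (simp add: D_def)
    then show ?thesis by (metis int_pow_int int_pow_mult int_pow_neg x)
  qed
  finally have "x [^] D = inv (v [^] j \<otimes> inv (t [^] e2)) \<otimes> (u [^] s \<otimes> inv (t [^] e1))" by simp
  also have "\<dots> \<in> H"
    by (intro subgroup.m_closed[OF H(1)] subgroup.m_inv_closed[OF H(1)]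
        subgroup_nat_pow_closed[OF H(1)] uv tH)
  finally show ?thesis using int_pow_coprime_mem[OF H(1) x cop] by blast
qed

text \<open>This is the core of minimal non-abelianness. It serves twice: for pairs of elements of G
  whose commutator is central of order p, and for the images of a and b in G/P, where it makes every
  proper subgroup abelian.\<close>

lemma noncommuting_imp_generate_subset:
  assumes p: "Factorial_Ring.prime p" and ord: "order G = p ^ e"
    and x: "x \<in> carrier G" and y: "y \<in> carrier G" and t: "central_elem t"
    and xy: "x \<otimes> y = y \<otimes> x \<otimes> t" and tp: "t [^] p = \<one>"
    and H: "subgroup H G" "H \<subseteq> generate G {x, y}"
    and uv: "u \<in> H" "v \<in> H" "u \<otimes> v \<noteq> v \<otimes> u"
  shows "generate G {x, y} \<subseteq> H"
proof -
  note [simp] = x y central_elem_closed[OF t]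
  have "x \<in> H" using noncommuting_mem[OF p ord x y t xy tp H uv] .
  moreover have "y \<in> H"
  \<comment> \<open>Exchanging x and y replaces their commutator t by its inverse.\<close>
  proof (rule noncommuting_mem[OF p ord y x central_elem_inv[OF t] _ _ H(1) _ uv])
    show "y \<otimes> x = x \<otimes> y \<otimes> inv t" unfolding xy by (simp add: m_assoc)
    show "inv t [^] p = \<one>" using tp by (simp add: nat_pow_inv)
    show "H \<subseteq> generate G {y, x}" using H(2) by (simp add: insert_commute)
  qed
  ultimately show ?thesis using generate_subgroup_incl[OF _ H(1)] by simp
qed

section \<open>Subgroups of index p and normal subgroups of order p\<close>

lemma order_prime_power_finite:
  assumes "order G = p ^ e" "Factorial_Ring.prime p"
  shows "finite (carrier G)"
proof -
  have "order G > 0" using assms by (simp add: prime_gt_0_nat)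
  then show ?thesis using order_gt_0_iff_finite by blast
qed

lemma nat_pow_mem_imp_mem:
  assumes p: "Factorial_Ring.prime p" and ord: "order G = p ^ e"
    and H: "subgroup H G" and x: "x \<in> carrier G"
    and d: "0 < d" "d < p" and xd: "x [^] (d::nat) \<in> H"
  shows "x \<in> H"
proof (rule int_pow_coprime_mem[OF H x])
  have "\<not> int p dvd int d" using d by (auto dest: nat_dvd_not_less)
  then show "coprime (int d) (int (order G))" using order_prime_power_coprime[OF ord p] by blast
  show "x [^] int d \<in> H" using xd by (simp add: int_pow_int)
qed

lemma conj_nat_pow:
  assumes "g \<in> carrier G" "h \<in> carrier G"
  shows "(g \<otimes> h \<otimes> inv g) [^] (d::nat) = g \<otimes> h [^] d \<otimes> inv g"
proof (induction d)
  case (Suc d)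
  have "(g \<otimes> h \<otimes> inv g) [^] Suc d = (g \<otimes> h [^] d \<otimes> inv g) \<otimes> (g \<otimes> h \<otimes> inv g)"
    by (simp only: nat_pow_Suc Suc)
  also have "\<dots> = g \<otimes> h [^] d \<otimes> (inv g \<otimes> g) \<otimes> h \<otimes> inv g"
    using assms by (simp only: m_assoc m_closed inv_closed nat_pow_closed)
  finally show ?case using assms by (simp add: m_assoc)
qed (use assms in simp)

text \<open>For g outside H, the p cosets H g h^i with i < p all differ from H, so two of them
  coincide among the p - 1 remaining ones. This puts g h^d g^(-1) into H for some 0 < d < p, and d
  is coprime to the order.\<close>

lemma prime_index_normal:
  assumes p: "Factorial_Ring.prime p" and ord: "order G = p ^ e"
    and H: "subgroup H G" and idx: "subgroup_index G H = p"
  shows "H \<lhd> G"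
  unfolding normal_inv_iff
proof (intro conjI ballI H)
  fix g h assume g: "g \<in> carrier G" and hH: "h \<in> H"
  have h: "h \<in> carrier G" using H hH by (rule subgroup.mem_carrier)
  note [simp] = g h
  have fin: "finite (carrier G)" using order_prime_power_finite[OF ord p] .
  show "g \<otimes> h \<otimes> inv g \<in> H"
  proof (cases "g \<in> H")
    case True then show ?thesis using H hH by (simp add: subgroup.m_closed subgroup.m_inv_closed)
  next
    case False
    have hpow: "h [^] (i::nat) \<in> H" for i
      using subgroup_nat_pow_closed[OF H hH] .
    have finr: "finite (rcosets H)"
      using fin by (simp add: RCOSETS_def)
    have Hr: "H \<in> rcosets H" using subgroup.subgroup_in_rcosets[OF H is_group] .
    have S: "finite (rcosets H - {H})" "card (rcosets H - {H}) < p"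
      using finr Hr idx p by (simp_all add: subgroup_index_def prime_gt_0_nat)
    have FS: "H #> (g \<otimes> h [^] i) \<in> rcosets H - {H}" for i :: nat
    proof -
      have "H #> (g \<otimes> h [^] i) \<noteq> H"
      proof
        assume "H #> (g \<otimes> h [^] i) = H"
        then have "g \<otimes> h [^] i \<in> H" using coset_join1[OF _ _ H] subgroup.subset[OF H] by simp
        then have "(g \<otimes> h [^] i) \<otimes> inv (h [^] i) \<in> H"
          using hpow H by (simp add: subgroup.m_closed subgroup.m_inv_closed)
        then show False using False by (simp add: m_assoc)
      qed
      then show ?thesis using rcosetsI[OF subgroup.subset[OF H]] by simp
    qed
    obtain i d :: nat where d: "0 < d" "d < p"
      and eq: "H #> (g \<otimes> h [^] i) = H #> (g \<otimes> h [^] (i + d))"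
      using pow_pigeonhole[OF S, of "\<lambda>i. H #> (g \<otimes> h [^] i)", OF FS] by metis
    have "g \<otimes> h [^] (i + d) \<in> H #> (g \<otimes> h [^] i)"
      unfolding eq by (rule rcos_self[OF _ H]) simp
    then have "g \<otimes> h [^] (i + d) \<otimes> inv (g \<otimes> h [^] i) \<in> H"
      using subgroup.rcos_module_imp[OF H is_group, of "g \<otimes> h [^] i"] by simp
    moreover have "g \<otimes> h [^] (i + d) \<otimes> inv (g \<otimes> h [^] i) = g \<otimes> h [^] d \<otimes> (h [^] i \<otimes> inv (h [^] i)) \<otimes> inv g"
      by (simp only: add.commute[of i] nat_pow_mult[symmetric] inv_mult_group m_assoc g h
          m_closed inv_closed nat_pow_closed)
    ultimately have "(g \<otimes> h \<otimes> inv g) [^] d \<in> H" by (simp add: conj_nat_pow)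
    then show ?thesis using nat_pow_mem_imp_mem[OF p ord H _ d] by simp
  qed
qed

lemma centralizer_subgroup:
  assumes z: "z \<in> carrier G"
  shows "subgroup {x \<in> carrier G. z \<otimes> x = x \<otimes> z} G"
proof (rule subgroupI)
  fix x y assume "x \<in> {x \<in> carrier G. z \<otimes> x = x \<otimes> z}" "y \<in> {x \<in> carrier G. z \<otimes> x = x \<otimes> z}"
  then have x: "x \<in> carrier G" "z \<otimes> x = x \<otimes> z" and y: "y \<in> carrier G" "z \<otimes> y = y \<otimes> z" by auto
  have "z \<otimes> (x \<otimes> y) = x \<otimes> z \<otimes> y" using x y z by (simp add: m_assoc[symmetric])
  also have "\<dots> = x \<otimes> (z \<otimes> y)" using m_assoc[OF x(1) z y(1)] .
  also have "\<dots> = x \<otimes> y \<otimes> z" unfolding y(2) using x(1) y(1) z by (simp add: m_assoc)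
  finally show "x \<otimes> y \<in> {x \<in> carrier G. z \<otimes> x = x \<otimes> z}" using x y by simp
next
  fix x assume "x \<in> {x \<in> carrier G. z \<otimes> x = x \<otimes> z}"
  then have x: "x \<in> carrier G" "z \<otimes> x = x \<otimes> z" by auto
  have "inv x \<otimes> (z \<otimes> x) \<otimes> inv x = inv x \<otimes> (x \<otimes> z) \<otimes> inv x" by (simp only: x(2))
  moreover have "inv x \<otimes> (z \<otimes> x) \<otimes> inv x = inv x \<otimes> z" using x(1) z by (simp add: m_assoc)
  moreover have "inv x \<otimes> (x \<otimes> z) \<otimes> inv x = z \<otimes> inv x" using x(1) z by (simp add: m_assoc[symmetric])
  ultimately show "inv x \<in> {x \<in> carrier G. z \<otimes> x = x \<otimes> z}" using x by simp
qed (use z in auto)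

text \<open>For z \<noteq> 1 the conjugates of z by g^i with i < p lie among the p - 1 non-trivial
  elements of N, so two coincide. Then some g^d with 0 < d < p centralizes z, and hence so does
  g.\<close>

lemma normal_prime_order_central:
  assumes p: "Factorial_Ring.prime p" and ord: "order G = p ^ e"
    and N: "N \<lhd> G" and cN: "card N = p" and z: "z \<in> N"
  shows "central_elem z"
proof -
  have zc: "z \<in> carrier G" using N z normal_imp_subgroup subgroup.mem_carrier by metis
  have comm: "z \<otimes> g = g \<otimes> z" if g: "g \<in> carrier G" for g
  proof (cases "z = \<one>")
    case True then show ?thesis using g by simp
  next
    case False
    let ?C = "{x \<in> carrier G. z \<otimes> x = x \<otimes> z}"
    note [simp] = g zc
    have C: "subgroup ?C G" using centralizer_subgroup[OF zc] .
    have "finite N" using cN p by (metis card.infinite not_prime_0)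
    then have S: "finite (N - {\<one>})" "card (N - {\<one>}) < p"
      using cN p subgroup.one_closed[OF normal_imp_subgroup[OF N]] by (simp_all add: prime_gt_0_nat)
    have FS: "g [^] i \<otimes> z \<otimes> inv (g [^] i) \<in> N - {\<one>}" for i :: nat
    proof -
      have "g [^] i \<otimes> z \<otimes> inv (g [^] i) \<in> N"
        using N z by (simp add: normal_inv_iff)
      moreover have "g [^] i \<otimes> z \<otimes> inv (g [^] i) \<noteq> \<one>"
        using False inv_solve_right'[of \<one> "g [^] i \<otimes> z" "g [^] i"] by auto
      ultimately show ?thesis by simp
    qed
    obtain i d :: nat where d: "0 < d" "d < p"
      and eq: "g [^] i \<otimes> z \<otimes> inv (g [^] i) = g [^] (i + d) \<otimes> z \<otimes> inv (g [^] (i + d))"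
      using pow_pigeonhole[OF S, of "\<lambda>i. g [^] i \<otimes> z \<otimes> inv (g [^] i)", OF FS] by metis
    have "g [^] i \<otimes> (z \<otimes> inv (g [^] i)) = g [^] i \<otimes> ((g [^] d \<otimes> z \<otimes> inv (g [^] d)) \<otimes> inv (g [^] i))"
      using eq by (simp add: nat_pow_mult[symmetric] inv_mult_group m_assoc)
    then have "z \<otimes> inv (g [^] i) = (g [^] d \<otimes> z \<otimes> inv (g [^] d)) \<otimes> inv (g [^] i)"
      by (rule l_cancel) simp_all
    then have "z = g [^] d \<otimes> z \<otimes> inv (g [^] d)"
      by (rule r_cancel) simp_all
    then have "z \<otimes> g [^] d = g [^] d \<otimes> z"
      by (simp add: inv_solve_right)
    then have "g [^] d \<in> ?C" by simp
    then show ?thesis using nat_pow_mem_imp_mem[OF p ord C g d] by blast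
  qed
  then show ?thesis using zc by (simp add: central_elem_def)
qed

section \<open>Counting cosets and elements of exponent p\<close>

lemma order_le_of_cover:
  assumes "finite S" "finite K" "carrier G \<subseteq> (\<lambda>(s, k). s \<otimes> k) ` (S \<times> K)"
  shows "order G \<le> card S * card K"
  using assms card_mono[of "(\<lambda>(s, k). s \<otimes> k) ` (S \<times> K)" "carrier G"]
    card_image_le[of "S \<times> K" "\<lambda>(s, k). s \<otimes> k"]
  unfolding order_def by (simp add: card_cartesian_product)

lemma subgroup_index_mult_card:
  assumes "subgroup H G" shows "subgroup_index G H * card H = order G"
  using lagrange[OF assms] by (simp add: subgroup_index_def)

text \<open>The elements in question form the kernel of the p-th power map, so their number is the
  index of its image, the subgroup of p-th powers; two generators make that index at most
  p^2.\<close>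

lemma card_exponent_p_le:
  assumes comm: "comm_group G" and fin: "finite (carrier G)" and p: "p > 0"
    and uv: "u \<in> carrier G" "v \<in> carrier G" and gen: "carrier G \<subseteq> generate G {u, v}"
  shows "card {w \<in> carrier G. w [^] (p::nat) = \<one>} \<le> p ^ 2"
proof -
  interpret comm_group G by fact
  let ?f = "\<lambda>w. w [^] p" let ?I = "?f ` carrier G"
  interpret f: group_hom G G ?f
    by unfold_locales (auto simp: hom_def nat_pow_distrib)
  have K: "kernel G G ?f = {w \<in> carrier G. w [^] p = \<one>}" by (auto simp: kernel_def)
  have I: "subgroup ?I G" using f.img_is_subgroup .
  \<comment> \<open>Shrinking the codomain to the image makes the map surjective, as the first
    isomorphism theorem requires.\<close>
  interpret fI: group_hom G "G\<lparr>carrier := ?I\<rparr>" ?f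
    using subgroup.subgroup_is_group[OF I is_group]
    by (intro group_hom.intro group_hom_axioms.intro is_group) (auto simp: hom_def nat_pow_distrib)
  have "card (rcosets (kernel G G ?f)) = card ?I"
    using iso_same_card[OF fI.FactGroup_iso] by (simp add: FactGroup_def kernel_def)
  then have "card ?I * card (kernel G G ?f) = order G"
    using lagrange[OF f.subgroup_kernel] by simp
  moreover have "order G \<le> p ^ 2 * card ?I"
  proof -
    let ?S = "(\<lambda>(j, i). v [^] j \<otimes> u [^] i) ` ({..<p} \<times> {..<p})"
    have "carrier G \<subseteq> (\<lambda>(s, k). s \<otimes> k) ` (?S \<times> ?I)"
    proof
      fix g assume "g \<in> carrier G"
      then have "g \<in> generate G {u, v}" using gen by blast
      then obtain j i :: nat where g: "g = v [^] j \<otimes> u [^] i"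
        using generate_normal_form[OF fin uv, of \<one> g] uv m_comm
        by (auto simp: central_elem_def)
      \<comment> \<open>The remainders modulo p leave p^2 representatives; the quotients combine
        into one p-th power.\<close>
      have "g = (v [^] (j mod p) \<otimes> u [^] (i mod p)) \<otimes> ((v [^] (j div p) \<otimes> u [^] (i div p)) [^] p)"
        unfolding g using uv nat_pow_mod_split[OF uv(1), of i p] nat_pow_mod_split[OF uv(2), of j p]
        by (simp add: nat_pow_distrib nat_pow_pow mult.commute m_ac)
      moreover have "v [^] (j mod p) \<otimes> u [^] (i mod p) \<in> ?S" using p by force
      ultimately show "g \<in> (\<lambda>(s, k). s \<otimes> k) ` (?S \<times> ?I)" using uv by blast
    qed
    then have "order G \<le> card ?S * card ?I"
      using fin by (intro order_le_of_cover) auto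
    also have "card ?S \<le> p ^ 2"
      using card_image_le[of "{..<p} \<times> {..<p}" "\<lambda>(j, i). v [^] j \<otimes> u [^] i"]
      by (simp add: card_cartesian_product power2_eq_square)
    finally show ?thesis by simp
  qed
  ultimately have "card ?I * card (kernel G G ?f) \<le> card ?I * p ^ 2" by (simp add: mult.commute)
  moreover have "card ?I > 0" using fin by (auto simp: card_gt_0_iff)
  ultimately show ?thesis unfolding K by simp
qed

section \<open>Minimal non-abelian subgroups\<close>

lemma comm_group_subgroupI:
  assumes "subgroup H G" "\<And>u v. u \<in> H \<Longrightarrow> v \<in> H \<Longrightarrow> u \<otimes> v = v \<otimes> u"
  shows "comm_group (G\<lparr>carrier := H\<rparr>)"
  using assms subgroup.subgroup_is_group[OF assms(1) is_group]
  by (intro group.group_comm_groupI) auto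

lemma comm_group_subgroupD:
  assumes "comm_group (G\<lparr>carrier := H\<rparr>)" "u \<in> H" "v \<in> H"
  shows "u \<otimes> v = v \<otimes> u"
  using comm_monoid.m_comm[OF comm_group.axioms(1)[OF assms(1)], of u v] assms by simp

lemma subgroup_finite_p_group:
  assumes p: "Factorial_Ring.prime p" and ord: "order G = p ^ e" and H: "subgroup H G"
  shows "finite_p_group p (G\<lparr>carrier := H\<rparr>)"
proof -
  have "card H dvd p ^ e" using subgroup_index_mult_card[OF H] ord by (metis dvd_triv_right)
  then obtain k where "card H = p ^ k" using p by (auto simp: divides_primepow_nat)
  then show ?thesis using subgroup.subgroup_is_group[OF H is_group]
    by (auto simp: finite_p_group_def order_def)
qed

lemma A1_subgroup_generate:
  assumes p: "Factorial_Ring.prime p" and ord: "order G = p ^ e"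
    and x: "x \<in> carrier G" and y: "y \<in> carrier G" and t: "central_elem t"
    and xy: "x \<otimes> y = y \<otimes> x \<otimes> t" and tp: "t [^] p = \<one>" and t1: "t \<noteq> \<one>"
  shows "A1_subgroup p (generate G {x, y}) G"
  unfolding A1_subgroup_def A1_group_def
proof (intro conjI allI impI)
  let ?K = "generate G {x, y}"
  show K: "subgroup ?K G" using generate_is_subgroup x y by simp
  show "finite_p_group p (G\<lparr>carrier := ?K\<rparr>)" using subgroup_finite_p_group[OF p ord K] .
  show "\<not> comm_group (G\<lparr>carrier := ?K\<rparr>)"
  proof
    assume "comm_group (G\<lparr>carrier := ?K\<rparr>)"
    then have "x \<otimes> y = y \<otimes> x" by (rule comm_group_subgroupD) (auto intro: generate.incl)
    then show False using xy t1 x y central_elem_closed[OF t] by simp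
  qed
  fix H assume H: "subgroup H (G\<lparr>carrier := ?K\<rparr>) \<and> H \<noteq> carrier (G\<lparr>carrier := ?K\<rparr>)"
  then have HG: "subgroup H G" and HK: "H \<subseteq> ?K" and HnK: "H \<noteq> ?K"
    using incl_subgroup[OF K] subgroup.subset by fastforce+
  have "comm_group (G\<lparr>carrier := H\<rparr>)"
    using noncommuting_imp_generate_subset[OF p ord x y t xy tp HG HK] HK HnK
    by (intro comm_group_subgroupI[OF HG]) blast
  then show "comm_group (G\<lparr>carrier := ?K, carrier := H\<rparr>)" by simp
qed

text \<open>Any two non-commuting elements of H generate a non-abelian subgroup, which by minimality
  cannot be proper.\<close>

lemma A1_subgroup_two_generated:
  assumes "A1_subgroup p H G"
  obtains u v where "u \<in> H" "v \<in> H" "u \<otimes> v \<noteq> v \<otimes> u" "generate G {u, v} = H"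
proof -
  have H: "subgroup H G" and nc: "\<not> comm_group (G\<lparr>carrier := H\<rparr>)"
    and min: "\<And>K. subgroup K (G\<lparr>carrier := H\<rparr>) \<Longrightarrow> K \<noteq> H \<Longrightarrow> comm_group (G\<lparr>carrier := K\<rparr>)"
    using assms by (auto simp: A1_subgroup_def A1_group_def)
  obtain u v where uv: "u \<in> H" "v \<in> H" "u \<otimes> v \<noteq> v \<otimes> u"
    using nc comm_group_subgroupI[OF H] by blast
  let ?K = "generate G {u, v}"
  have KH: "?K \<subseteq> H" using generate_subgroup_incl[OF _ H] uv by simp
  have K: "subgroup ?K G" using generate_is_subgroup uv subgroup.mem_carrier[OF H] by simp
  have "?K = H"
  proof (rule ccontr)
    assume "?K \<noteq> H"
    moreover have "subgroup ?K (G\<lparr>carrier := H\<rparr>)" using subgroup_incl[OF K H KH] .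
    ultimately have "comm_group (G\<lparr>carrier := ?K\<rparr>)" using min by blast
    then have "u \<otimes> v = v \<otimes> u" by (rule comm_group_subgroupD) (auto intro: generate.incl)
    then show False using uv by blast
  qed
  then show thesis using that uv by blast
qed

section \<open>Relations of M_p(n,m,1), unique normal forms, commutator formulas\<close>

lemma word_value_replicate:
  assumes "f x \<in> carrier G"
  shows "word_value G f (replicate N (x, True)) = f x [^] N"
proof (induction N)
  case (Suc N)
  then show ?case using nat_pow_Suc2[OF assms, of N] by (simp add: word_value_def)
qed (simp add: word_value_def)

lemma Mp_relations_elim:
  assumes abc: "a \<in> carrier G" "b \<in> carrier G" "c \<in> carrier G"
    and sat: "satisfies_relations G (case_gen a b c) (Mp_relations p n m)"
  shows "a [^] (p ^ n) = \<one>" "b [^] (p ^ m) = \<one>" "c [^] p = \<one>"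
    and "a \<otimes> b = b \<otimes> a \<otimes> c" "c \<otimes> a = a \<otimes> c" "c \<otimes> b = b \<otimes> c"
proof -
  let ?f = "case_gen a b c"
  note [simp] = abc
  have rel: "word_value G ?f u = word_value G ?f v" if "(u, v) \<in> Mp_relations p n m" for u v
    using sat that by (auto simp: satisfies_relations_def)
  have nil: "word_value G ?f [] = \<one>" by (simp add: word_value_def)
  show "a [^] (p ^ n) = \<one>" "b [^] (p ^ m) = \<one>" "c [^] p = \<one>"
    using rel[of "replicate (p ^ n) (GenA, True)" "[]"] rel[of "replicate (p ^ m) (GenB, True)" "[]"]
      rel[of "replicate p (GenC, True)" "[]"]
    by (simp_all add: Mp_relations_def Let_def word_value_replicate nil)
  have comm: "x \<otimes> y = y \<otimes> x \<otimes> z"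
    if "inv x \<otimes> (inv y \<otimes> (x \<otimes> y)) = z" and [simp]: "x \<in> carrier G" "y \<in> carrier G" for x y z
  proof -
    have "y \<otimes> x \<otimes> z = y \<otimes> (x \<otimes> inv x) \<otimes> inv y \<otimes> (x \<otimes> y)"
      unfolding that(1)[symmetric] by (simp only: m_assoc that(2,3) m_closed inv_closed)
    then show ?thesis by simp
  qed
  show "a \<otimes> b = b \<otimes> a \<otimes> c"
    using rel[of "comm_word [(GenA, True)] [(GenB, True)]" "[(GenC, True)]"]
    by (intro comm) (simp_all add: Mp_relations_def Let_def comm_word_def inv_word_def word_value_def)
  have "c \<otimes> a = a \<otimes> c \<otimes> \<one>"
    using rel[of "comm_word [(GenC, True)] [(GenA, True)]" "[]"]
    by (intro comm) (simp_all add: Mp_relations_def Let_def comm_word_def inv_word_def word_value_def)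
  then show "c \<otimes> a = a \<otimes> c" by simp
  have "c \<otimes> b = b \<otimes> c \<otimes> \<one>"
    using rel[of "comm_word [(GenC, True)] [(GenB, True)]" "[]"]
    by (intro comm) (simp_all add: Mp_relations_def Let_def comm_word_def inv_word_def word_value_def)
  then show "c \<otimes> b = b \<otimes> c" by simp
qed

lemma central_elem_of_generators:
  assumes z: "z \<in> carrier G" and gen: "carrier G \<subseteq> generate G S" and S: "S \<subseteq> carrier G"
    and comm: "\<And>x. x \<in> S \<Longrightarrow> z \<otimes> x = x \<otimes> z"
  shows "central_elem z"
  using generate_subgroup_incl[OF _ centralizer_subgroup[OF z], of S] assms
  unfolding central_elem_def by blast

text \<open>Reducing exponents shows that the box of p^(n+m+1) triples maps onto G. As G has at
  least that many elements, the map is also injective.\<close>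

lemma normal_form_inj_on:
  assumes p: "p > 0" and fin: "finite (carrier G)"
    and a: "a \<in> carrier G" and b: "b \<in> carrier G" and c: "central_elem c"
    and ab: "a \<otimes> b = b \<otimes> a \<otimes> c"
    and pow: "a [^] (p ^ n) = \<one>" "b [^] (p ^ m) = \<one>" "c [^] p = \<one>"
    and gen: "carrier G \<subseteq> generate G {a, b}" and ord: "p ^ (n + m + 1) \<le> order G"
  shows "inj_on (\<lambda>(j, i, k). b [^] j \<otimes> a [^] i \<otimes> c [^] k) ({..<p ^ m} \<times> {..<p ^ n} \<times> {..<p})"
    (is "inj_on ?f ?B")
proof -
  note [simp] = a b central_elem_closed[OF c]
  have e: "w [^] i = w [^] (i mod N)" if "w \<in> carrier G" "w [^] N = \<one>" for w and i N :: nat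
    using nat_pow_mod_split[OF that(1), of i N] that by simp
  have "carrier G \<subseteq> ?f ` ?B"
  proof
    fix g assume "g \<in> carrier G"
    then obtain j i k :: nat where "g = b [^] j \<otimes> a [^] i \<otimes> c [^] k"
      using generate_normal_form[OF fin a b c ab] gen by blast
    then have "g = ?f (j mod p ^ m, i mod p ^ n, k mod p)"
      using e[OF a pow(1), of i] e[OF b pow(2), of j] e[OF _ pow(3), of k] by simp
    moreover have "(j mod p ^ m, i mod p ^ n, k mod p) \<in> ?B" using p by simp
    ultimately show "g \<in> ?f ` ?B" by (rule image_eqI)
  qed
  then have "order G \<le> card (?f ` ?B)" unfolding order_def by (intro card_mono) auto
  then have "card ?B \<le> card (?f ` ?B)"
    using ord by (simp add: card_cartesian_product power_add mult_ac)
  then show ?thesis by (intro eq_card_imp_inj_on) (use card_image_le[of ?B ?f] in auto)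
qed

lemma normal_form_eq_one:
  assumes p: "p > 0" and a: "a \<in> carrier G" and b: "b \<in> carrier G" and c: "c \<in> carrier G"
    and pow: "a [^] (p ^ n) = \<one>" "b [^] (p ^ m) = \<one>" "c [^] p = \<one>"
    and inj: "inj_on (\<lambda>(j, i, k). b [^] j \<otimes> a [^] i \<otimes> c [^] k) ({..<p ^ m} \<times> {..<p ^ n} \<times> {..<p})"
    and eq: "b [^] (j::nat) \<otimes> a [^] (i::nat) \<otimes> c [^] (k::nat) = \<one>"
  shows "p ^ m dvd j" "p ^ n dvd i" "p dvd k"
proof -
  have e: "w [^] i = w [^] (i mod N)" if "w \<in> carrier G" "w [^] N = \<one>" for w and i N :: nat
    using nat_pow_mod_split[OF that(1), of i N] that by simp
  have "(j mod p ^ m, i mod p ^ n, k mod p) = (0, 0, 0)"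
    by (rule inj_onD[OF inj])
      (use eq p e[OF a pow(1), of i] e[OF b pow(2), of j] e[OF c pow(3), of k] in auto)
  then show "p ^ m dvd j" "p ^ n dvd i" "p dvd k" by auto
qed

lemma normal_form_commutator:
  assumes fin: "finite (carrier G)" and p: "p > 0"
    and x: "x \<in> carrier G" and y: "y \<in> carrier G" and t: "central_elem t"
    and xy: "x \<otimes> y = y \<otimes> x \<otimes> t" and tp: "t [^] (p::nat) = \<one>"
    and u: "u \<in> generate G {x, y}" and v: "v \<in> generate G {x, y}"
  shows "\<exists>k::nat. u \<otimes> v \<otimes> inv u \<otimes> inv v = t [^] k"
proof -
  note [simp] = x y central_elem_closed[OF t]
  obtain j i k :: nat where u': "u = y [^] j \<otimes> x [^] i \<otimes> t [^] k"
    using generate_normal_form[OF fin x y t xy u] by blast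
  obtain s r l :: nat where v': "v = y [^] s \<otimes> x [^] r \<otimes> t [^] l"
    using generate_normal_form[OF fin x y t xy v] by blast
  have [simp]: "u \<in> carrier G" "v \<in> carrier G" by (simp_all add: u' v')
  \<comment> \<open>The factor p - 1 stands for -1 modulo the exponent p of t, which keeps the
    determinant i s - r j a natural number.\<close>
  define D where "D = i * s + (p - 1) * (r * j)"
  have "u \<otimes> v = y [^] (j + s) \<otimes> x [^] (i + r) \<otimes> t [^] (k + l + i * s)"
    unfolding u' v' by (rule normal_form_mult[OF x y t xy])
  moreover have "v \<otimes> u = y [^] (j + s) \<otimes> x [^] (i + r) \<otimes> t [^] (k + l + r * j)"
    unfolding u' v' normal_form_mult[OF x y t xy] by (simp add: add.commute)
  moreover have "t [^] (k + l + i * s) = t [^] (k + l + r * j) \<otimes> t [^] D"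
  proof -
    have "k + l + r * j + D = (k + l + i * s) + p * (r * j)"
      using p by (cases p) (simp_all add: D_def algebra_simps)
    then have "t [^] (k + l + r * j) \<otimes> t [^] D = t [^] (k + l + i * s) \<otimes> (t [^] p) [^] (r * j)"
      by (simp only: nat_pow_mult nat_pow_pow central_elem_closed[OF t])
    then show ?thesis by (simp add: tp)
  qed
  ultimately have "u \<otimes> v = v \<otimes> u \<otimes> t [^] D" by (simp add: m_assoc)
  also have "\<dots> = t [^] D \<otimes> (v \<otimes> u)"
    using central_elem_comm[OF central_elem_pow[OF t]] by simp
  finally have uv: "u \<otimes> v = t [^] D \<otimes> (v \<otimes> u)" .
  have "u \<otimes> v \<otimes> inv u \<otimes> inv v = t [^] D \<otimes> (v \<otimes> u) \<otimes> inv u \<otimes> inv v"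
    by (simp only: uv)
  also have "\<dots> = t [^] D \<otimes> ((v \<otimes> u) \<otimes> (inv u \<otimes> inv v))"
    by (simp only: m_assoc m_closed inv_closed nat_pow_closed central_elem_closed[OF t]
        \<open>u \<in> carrier G\<close> \<open>v \<in> carrier G\<close>)
  also have "(v \<otimes> u) \<otimes> (inv u \<otimes> inv v) = \<one>"
    using r_inv[of "v \<otimes> u"] by (simp only: inv_mult_group m_closed \<open>u \<in> carrier G\<close> \<open>v \<in> carrier G\<close>)
  finally show ?thesis by (intro exI[of _ D]) simp
qed

text \<open>In step k the new y has to pass c^k, which costs s^k because s = [c,y] is central; the
  costs 0 + 1 + ... + (k - 1) add up to k choose 2.\<close>

lemma mult_pow_of_commutator:
  assumes x: "x \<in> carrier G" and y: "y \<in> carrier G" and c: "c \<in> carrier G" and s: "central_elem s"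
    and xy: "x \<otimes> y = y \<otimes> x \<otimes> c" and cy: "c \<otimes> y = y \<otimes> c \<otimes> s"
  shows "x \<otimes> y [^] (k::nat) = y [^] k \<otimes> x \<otimes> c [^] k \<otimes> s [^] (k choose 2)"
proof (induction k)
  case 0 then show ?case using x by (simp add: binomial_eq_0)
next
  case (Suc k)
  note [simp] = x y c central_elem_closed[OF s]
  have "x \<otimes> y [^] Suc k = (y [^] k \<otimes> x \<otimes> c [^] k \<otimes> s [^] (k choose 2)) \<otimes> y"
    by (simp only: nat_pow_Suc m_assoc[symmetric] Suc x y nat_pow_closed)
  also have "\<dots> = y [^] k \<otimes> x \<otimes> c [^] k \<otimes> (s [^] (k choose 2) \<otimes> y)"
    by (simp add: m_assoc)
  also have "s [^] (k choose 2) \<otimes> y = y \<otimes> s [^] (k choose 2)"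
    using central_elem_comm[OF central_elem_pow[OF s]] by simp
  also have "y [^] k \<otimes> x \<otimes> c [^] k \<otimes> (y \<otimes> s [^] (k choose 2))
      = y [^] k \<otimes> x \<otimes> (c [^] k \<otimes> y) \<otimes> s [^] (k choose 2)"
    by (simp add: m_assoc)
  also have "c [^] k \<otimes> y = y \<otimes> c [^] k \<otimes> s [^] k"
    using pow_mult_pow_of_mult[OF c y s cy, of k 1] by simp
  also have "y [^] k \<otimes> x \<otimes> (y \<otimes> c [^] k \<otimes> s [^] k) \<otimes> s [^] (k choose 2)
      = y [^] k \<otimes> (x \<otimes> y) \<otimes> c [^] k \<otimes> (s [^] k \<otimes> s [^] (k choose 2))"
    by (simp add: m_assoc)
  also have "\<dots> = (y [^] k \<otimes> y) \<otimes> x \<otimes> (c \<otimes> c [^] k) \<otimes> (s [^] k \<otimes> s [^] (k choose 2))"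
    unfolding xy by (simp add: m_assoc)
  also have "\<dots> = y [^] Suc k \<otimes> x \<otimes> c [^] Suc k \<otimes> s [^] (Suc k choose 2)"
    by (simp only: nat_pow_Suc2[OF c] nat_pow_Suc[of y] nat_pow_mult[OF central_elem_closed[OF s]])
      (simp add: numeral_2_eq_2)
  finally show ?case .
qed

section \<open>Subgroups meeting a group of order p, quotients of order p\<close>

lemma prime_card_subgroup_subset:
  assumes p: "Factorial_Ring.prime p" and P: "subgroup P G" "card P = p"
    and H: "subgroup H G" and z: "z \<in> P" "z \<in> H" "z \<noteq> \<one>"
  shows "P \<subseteq> H"
proof -
  have fin: "finite P" using P p by (metis card.infinite not_prime_0)
  interpret P: group "G\<lparr>carrier := P\<rparr>" using subgroup.subgroup_is_group[OF P(1) is_group] .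
  have "subgroup (P \<inter> H) (G\<lparr>carrier := P\<rparr>)"
    using subgroup_incl[OF subgroups_Inter_pair[OF P(1) H] P(1)] by simp
  then have "card (rcosets\<^bsub>G\<lparr>carrier := P\<rparr>\<^esub> (P \<inter> H)) * card (P \<inter> H) = p"
    using P.lagrange P(2) by (simp add: order_def)
  then have "card (P \<inter> H) dvd p" by auto
  moreover have "card (P \<inter> H) \<noteq> 1"
  proof
    assume "card (P \<inter> H) = 1"
    then obtain w where "P \<inter> H = {w}" by (auto simp: card_1_singleton_iff)
    moreover have "\<one> \<in> P \<inter> H" using P(1) H by (simp add: subgroup.one_closed)
    ultimately show False using z by auto
  qed
  ultimately have "card (P \<inter> H) = card P" using p P(2) by (auto simp: prime_nat_iff)
  then show ?thesis using fin by (metis card_subset_eq inf_le1 inf.absorb_iff1)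
qed

text \<open>G/H has order p. As a normal subgroup of order p of itself it is central, hence abelian;
  its elements are killed by p.\<close>

lemma prime_index_derived_subset:
  assumes p: "Factorial_Ring.prime p" and ord: "order G = p ^ e"
    and H: "subgroup H G" and idx: "subgroup_index G H = p"
  shows "derived G (carrier G) \<subseteq> H" and "g \<in> carrier G \<Longrightarrow> g [^] p \<in> H"
proof -
  have N: "H \<lhd> G" using prime_index_normal[OF p ord H idx] .
  interpret Q: group "G Mod H" using normal.factorgroup_is_group[OF N] .
  have oQ: "order (G Mod H) = p ^ 1" using idx by (simp add: order_def FactGroup_def subgroup_index_def)
  have "Q.central_elem u" if "u \<in> carrier (G Mod H)" for u
    using Q.normal_prime_order_central[OF p oQ Q.normal_self _ that] oQ by (simp add: order_def)
  then have "comm_group (G Mod H)"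
    by (intro Q.group_comm_groupI) (rule Q.central_elem_comm)
  then show "derived G (carrier G) \<subseteq> H" using derived_minimal[OF N] by blast
  assume g: "g \<in> carrier G"
  have "(H #> g) [^]\<^bsub>G Mod H\<^esub> p = \<one>\<^bsub>G Mod H\<^esub>"
    using Q.pow_order_eq_1[of "H #> g"] g oQ by (simp add: carrier_FactGroup)
  then have "H #> (g [^] p) = H" using normal.FactGroup_pow[OF N g] by simp
  then show "g [^] p \<in> H" using coset_join1[OF _ _ H] g subgroup.subset[OF H] by simp
qed

lemma frattini_subgroup: "subgroup (frattini G) G"
proof -
  have F: "x \<in> frattini G \<longleftrightarrow> x \<in> carrier G \<and> (\<forall>M. maximal_subgroup M G \<longrightarrow> x \<in> M)" for x
    by (auto simp: frattini_def)
  have M: "subgroup M G" if "maximal_subgroup M G" for M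
    using that by (simp add: maximal_subgroup_def)
  show ?thesis
  proof (rule subgroupI)
    show "frattini G \<noteq> {}" using M subgroup.one_closed[of _ G] F one_closed by blast
  qed (use F M in \<open>auto intro: subgroup.m_inv_closed subgroup.m_closed\<close>)
qed

end

section \<open>Extensions of $M_p(n,m,1)$ by a Frattini subgroup of order $p$\<close>

locale Mp_extension = group G for G (structure) +
  fixes p e n m :: nat and a b c :: 'a and P :: "'a set"
  assumes P_def: "P = frattini (G\<lparr>carrier := derived_subgroup G\<rparr>)"
    and c_def: "c = commutator G a b"
    and prime: "Factorial_Ring.prime p" and ord: "order G = p ^ e"
    and m_ge: "1 \<le> m" and n_ge: "m \<le> n" and n_gt: "p = 2 \<Longrightarrow> n > 1"
    and lower_central: "lower_central_3 G \<subseteq> P"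
    and P_iso: "G\<lparr>carrier := P\<rparr> \<cong> integer_mod_group p"
    and Q_iso: "G Mod P \<cong> Mp p n m"
    and a [simp]: "a \<in> carrier G" and b [simp]: "b \<in> carrier G"
    and Q_gen: "generate (G Mod P) {P #> a, P #> b} = carrier (G Mod P)"
    and Q_rel: "satisfies_relations (G Mod P) (case_gen (P #> a) (P #> b) (P #> c)) (Mp_relations p n m)"
begin

section \<open>The derived subgroup and its Frattini subgroup P\<close>

abbreviation N where "N \<equiv> derived G (carrier G)"

lemma p_gt: "p > 0" "p > 1"
  using prime prime_gt_0_nat prime_gt_1_nat by auto

lemma fin: "finite (carrier G)"
  using order_prime_power_finite[OF ord prime] .

lemma c_carrier [simp]: "c \<in> carrier G"
  by (simp add: c_def commutator_def)

lemma commutator_closed [simp]: "x \<in> carrier G \<Longrightarrow> y \<in> carrier G \<Longrightarrow> commutator G x y \<in> carrier G"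
  by (simp add: commutator_def)

lemma mult_commutator:
  assumes "x \<in> carrier G" "y \<in> carrier G" shows "x \<otimes> y = y \<otimes> x \<otimes> commutator G x y"
proof -
  have "y \<otimes> x \<otimes> commutator G x y = y \<otimes> (x \<otimes> inv x) \<otimes> inv y \<otimes> (x \<otimes> y)"
    unfolding commutator_def using assms by (simp only: m_assoc m_closed inv_closed)
  then show ?thesis using assms by simp
qed

lemma N_normal: "N \<lhd> G"
  by (rule derived_self_is_normal)

lemma N_subgroup: "subgroup N G"
  using N_normal by (rule normal_imp_subgroup)

lemma commutator_N: "x \<in> carrier G \<Longrightarrow> y \<in> carrier G \<Longrightarrow> commutator G x y \<in> N"
proof -
  assume xy: "x \<in> carrier G" "y \<in> carrier G"
  then have "commutator G x y = inv x \<otimes> inv y \<otimes> inv (inv x) \<otimes> inv (inv y)"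
    by (simp add: commutator_def)
  moreover have "inv x \<in> carrier G" "inv y \<in> carrier G" using xy by simp_all
  ultimately show ?thesis unfolding derived_def by (intro generate.incl) blast
qed

lemma P_subset_N: "P \<subseteq> N"
  unfolding P_def frattini_def derived_subgroup_def by auto

lemma P_subgroup: "subgroup P G"
proof -
  interpret N: group "G\<lparr>carrier := N\<rparr>" using subgroup.subgroup_is_group[OF N_subgroup is_group] .
  have "subgroup P (G\<lparr>carrier := N\<rparr>)"
    using N.frattini_subgroup by (simp add: P_def derived_subgroup_def)
  then show ?thesis using incl_subgroup[OF N_subgroup] by blast
qed

lemma P_carrier: "z \<in> P \<Longrightarrow> z \<in> carrier G"
  using subgroup.mem_carrier[OF P_subgroup] .

lemma card_P: "card P = p"
  using iso_same_card[OF P_iso] p_gt by (simp add: carrier_integer_mod_group)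

lemma commutator_P:
  assumes "d \<in> N" "g \<in> carrier G" shows "commutator G d g \<in> P"
proof -
  have "commutator G d g \<in> lower_central_3 G"
    unfolding lower_central_3_def commutator_subgroup_def derived_subgroup_def
    using assms by (intro generate.incl) blast
  then show ?thesis using lower_central by blast
qed

text \<open>Since G_3 \<le> P, the commutator [z, g^(-1)] lies in P, and z [z, g^(-1)] is the
  conjugate g z g^(-1).\<close>

lemma P_normal: "P \<lhd> G"
  unfolding normal_inv_iff
proof (intro conjI ballI P_subgroup)
  fix g z assume g: "g \<in> carrier G" and z: "z \<in> P"
  have zc: "z \<in> carrier G" using P_carrier z .
  have "commutator G z (inv g) \<in> P" using commutator_P z P_subset_N g by blast
  then have "z \<otimes> commutator G z (inv g) \<in> P" using z P_subgroup by (simp add: subgroup.m_closed)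
  moreover have "z \<otimes> commutator G z (inv g) = (z \<otimes> inv z) \<otimes> g \<otimes> z \<otimes> inv g"
    unfolding commutator_def using g zc by (simp only: m_assoc m_closed inv_closed inv_inv)
  ultimately show "g \<otimes> z \<otimes> inv g \<in> P" using g zc by simp
qed

lemma P_central: "z \<in> P \<Longrightarrow> central_elem z"
  using normal_prime_order_central[OF prime ord P_normal card_P] .

lemma P_pow: "z \<in> P \<Longrightarrow> z [^] p = \<one>"
proof -
  assume z: "z \<in> P"
  interpret P: group "G\<lparr>carrier := P\<rparr>" using subgroup.subgroup_is_group[OF P_subgroup is_group] .
  show ?thesis using P.pow_order_eq_1[of z] z card_P nat_pow_consistent[of z p P] by (simp add: order_def)
qed

section \<open>The quotient G/P\<close>

abbreviation Q where "Q \<equiv> G Mod P"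
abbreviation proj where "proj \<equiv> \<lambda>g. P #> g"

lemma proj_hom: "group_hom G Q proj"
  using normal.r_coset_hom_Mod[OF P_normal] normal.factorgroup_is_group[OF P_normal]
  by (intro group_hom.intro group_hom_axioms.intro is_group)

sublocale Q: group Q
  using normal.factorgroup_is_group[OF P_normal] .

sublocale proj: group_hom G Q proj
  by (rule proj_hom)

lemma proj_eq_iff:
  assumes "g \<in> carrier G" "h \<in> carrier G"
  shows "P #> g = P #> h \<longleftrightarrow> (\<exists>z\<in>P. g = z \<otimes> h)"
proof
  assume "P #> g = P #> h"
  then have "g \<in> P #> h" using rcos_self[OF assms(1) P_subgroup] by simp
  then show "\<exists>z\<in>P. g = z \<otimes> h" by (auto simp: r_coset_def)
next
  assume "\<exists>z\<in>P. g = z \<otimes> h"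
  then have "g \<in> P #> h" by (auto simp: r_coset_def)
  then show "P #> g = P #> h" using repr_independence[OF _ assms(2) P_subgroup] by simp
qed

lemma proj_one_iff: "g \<in> carrier G \<Longrightarrow> P #> g = P \<longleftrightarrow> g \<in> P"
  using coset_join1[OF _ _ P_subgroup] coset_join2[OF _ P_subgroup] subgroup.subset[OF P_subgroup] by blast

lemma carrier_Q: "carrier Q = proj ` carrier G"
  by (rule carrier_FactGroup)

lemma fin_Q: "finite (carrier Q)"
  unfolding carrier_Q using fin by simp

text \<open>The isomorphism with \<open>Mp p n m\<close> enters through its order; generators and
  relations inside G/P come from \<open>Q_gen\<close> and \<open>Q_rel\<close>.\<close>

lemma order_Q: "p ^ (n + m + 1) \<le> order Q" "\<exists>k. order Q = p ^ k"
proof -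
  have same: "card (carrier Q) = card (carrier (Mp p n m))" using iso_same_card[OF Q_iso] .
  have "card (carrier Q) > 0" using fin_Q Q.one_closed by (auto simp: card_gt_0_iff)
  then have "finite (carrier (Mp p n m))" using same by (metis card_gt_0_iff)
  then show "p ^ (n + m + 1) \<le> order Q"
    using order_Mp_ge[of p n m] p_gt m_ge n_ge same by (simp add: order_def)
  have "order Q * card P = order G"
    using lagrange[OF P_subgroup] by (simp add: order_def FactGroup_def)
  then have "order Q dvd p ^ e" using ord by (metis dvd_triv_left)
  then show "\<exists>k. order Q = p ^ k" using prime by (auto simp: divides_primepow_nat)
qed

lemma proj_carrier [simp]: "g \<in> carrier G \<Longrightarrow> P #> g \<in> carrier Q"
  by (simp add: carrier_Q)

lemmas Q_relations = Q.Mp_relations_elim[OF proj_carrier[OF a] proj_carrier[OF b] proj_carrier[OF c_carrier] Q_rel]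

lemma Q_central: "Q.central_elem (P #> c)"
  by (rule Q.central_elem_of_generators[of _ "{P #> a, P #> b}"])
    (use Q_gen Q_relations(5,6) in auto)

lemma Q_inj: "inj_on (\<lambda>(j, i, k). (P #> b) [^]\<^bsub>Q\<^esub> j \<otimes>\<^bsub>Q\<^esub> (P #> a) [^]\<^bsub>Q\<^esub> i \<otimes>\<^bsub>Q\<^esub> (P #> c) [^]\<^bsub>Q\<^esub> k)
    ({..<p ^ m} \<times> {..<p ^ n} \<times> {..<p})"
  by (rule Q.normal_form_inj_on[OF p_gt(1) fin_Q _ _ Q_central Q_relations(4,1,2,3)])
    (use Q_gen order_Q in auto)

lemma proj_normal_form:
  "P #> (b [^] (j::nat) \<otimes> a [^] (i::nat) \<otimes> c [^] (k::nat))
   = (P #> b) [^]\<^bsub>Q\<^esub> j \<otimes>\<^bsub>Q\<^esub> (P #> a) [^]\<^bsub>Q\<^esub> i \<otimes>\<^bsub>Q\<^esub> (P #> c) [^]\<^bsub>Q\<^esub> k"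
  by (simp only: proj.hom_mult proj.hom_nat_pow a b c_carrier m_closed nat_pow_closed)

lemma normal_form_P:
  assumes "b [^] (j::nat) \<otimes> a [^] (i::nat) \<otimes> c [^] (k::nat) \<in> P"
  shows "p ^ m dvd j" "p ^ n dvd i" "p dvd k"
proof -
  have "P #> (b [^] (j::nat) \<otimes> a [^] (i::nat) \<otimes> c [^] (k::nat)) = \<one>\<^bsub>Q\<^esub>"
    using assms proj_one_iff[of "b [^] j \<otimes> a [^] i \<otimes> c [^] k"] by (simp only: one_FactGroup P_carrier)
  then have *: "(P #> b) [^]\<^bsub>Q\<^esub> j \<otimes>\<^bsub>Q\<^esub> (P #> a) [^]\<^bsub>Q\<^esub> i \<otimes>\<^bsub>Q\<^esub> (P #> c) [^]\<^bsub>Q\<^esub> k = \<one>\<^bsub>Q\<^esub>"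
    unfolding proj_normal_form .
  show "p ^ m dvd j" "p ^ n dvd i" "p dvd k"
    using Q.normal_form_eq_one[OF p_gt(1) _ _ _ Q_relations(1-3) Q_inj *] by simp_all
qed

lemma c_pow_P_iff: "c [^] (k::nat) \<in> P \<longleftrightarrow> p dvd k"
proof
  assume "c [^] k \<in> P" then show "p dvd k" using normal_form_P(3)[of 0 0 k] by simp
next
  have cp: "c [^] p \<in> P"
    using Q_relations(3) proj_one_iff[of "c [^] p"] proj.hom_nat_pow[of c p] by simp
  assume "p dvd k"
  then obtain l where "k = p * l" by blast
  then have "c [^] k = (c [^] p) [^] l" by (simp add: nat_pow_pow)
  then show "c [^] k \<in> P" using subgroup_nat_pow_closed[OF P_subgroup cp] by simp
qed

lemma b_pow_P: "b [^] (p ^ m) \<in> P"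
  using Q_relations(2) proj_one_iff[of "b [^] (p ^ m)"] proj.hom_nat_pow[of b "p ^ m"] by simp

section \<open>The derived subgroup is cyclic\<close>

definition C where "C = range (\<lambda>k::nat. c [^] k)"

text \<open>Natural exponents suffice because G is finite, so membership in \<open>C\<close> yields
  a natural exponent at once.\<close>

lemma pow_range_subgroup:
  assumes "x \<in> carrier G" shows "subgroup (range (\<lambda>k::nat. x [^] k)) G"
  using assms by (intro finite_mult_closed_subgroup[OF fin]) (auto simp: nat_pow_mult)

lemma C_subgroup: "subgroup C G"
  unfolding C_def by (rule pow_range_subgroup) simp

lemma c_C: "c \<in> C" unfolding C_def by (rule range_eqI[of _ _ 1]) simp

text \<open>Modulo P the element c is central and G/P is generated by the images of a and b, so
  every commutator is there a power of c. The set of products c^k z is closed because P is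
  central.\<close>

lemma N_form:
  assumes "d \<in> N" shows "\<exists>k::nat. \<exists>z\<in>P. d = c [^] k \<otimes> z"
proof -
  let ?S = "{d. \<exists>k::nat. \<exists>z\<in>P. d = c [^] k \<otimes> z}"
  have "subgroup ?S G"
  proof (rule finite_mult_closed_subgroup[OF fin])
    fix g h assume "g \<in> ?S" "h \<in> ?S"
    then obtain k l :: nat and z w where g: "g = c [^] k \<otimes> z" "z \<in> P" and h: "h = c [^] l \<otimes> w" "w \<in> P"
      by blast
    note [simp] = P_carrier[OF g(2)] P_carrier[OF h(2)]
    have "g \<otimes> h = c [^] k \<otimes> (z \<otimes> c [^] l) \<otimes> w" unfolding g h by (simp add: m_assoc)
    also have "z \<otimes> c [^] l = c [^] l \<otimes> z" using central_elem_comm[OF P_central[OF g(2)]] by simp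
    also have "c [^] k \<otimes> (c [^] l \<otimes> z) \<otimes> w = c [^] (k + l) \<otimes> (z \<otimes> w)"
      by (simp add: m_assoc nat_pow_mult[symmetric])
    finally show "g \<otimes> h \<in> ?S" using subgroup.m_closed[OF P_subgroup g(2) h(2)] by blast
  next
    show "?S \<noteq> {}" using subgroup.one_closed[OF P_subgroup] by blast
  qed (auto dest: P_carrier)
  moreover have "derived_set G (carrier G) \<subseteq> ?S"
  proof clarify
    fix g h assume [simp]: "g \<in> carrier G" "h \<in> carrier G"
    have gh: "P #> g \<in> generate Q {P #> a, P #> b}" "P #> h \<in> generate Q {P #> a, P #> b}"
      unfolding Q_gen by simp_all
    obtain k :: nat where
      "(P #> g) \<otimes>\<^bsub>Q\<^esub> (P #> h) \<otimes>\<^bsub>Q\<^esub> inv\<^bsub>Q\<^esub> (P #> g) \<otimes>\<^bsub>Q\<^esub> inv\<^bsub>Q\<^esub> (P #> h) = (P #> c) [^]\<^bsub>Q\<^esub> k"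
      using Q.normal_form_commutator[OF fin_Q p_gt(1) proj_carrier[OF a] proj_carrier[OF b]
          Q_central Q_relations(4,3) gh] by blast
    then have "P #> (g \<otimes> h \<otimes> inv g \<otimes> inv h) = P #> (c [^] k)"
      by (simp only: proj.hom_mult proj.hom_nat_pow proj.hom_inv c_carrier m_closed inv_closed
          \<open>g \<in> carrier G\<close> \<open>h \<in> carrier G\<close>)
    then obtain z where z: "z \<in> P" "g \<otimes> h \<otimes> inv g \<otimes> inv h = z \<otimes> c [^] k"
      using proj_eq_iff[of "g \<otimes> h \<otimes> inv g \<otimes> inv h" "c [^] k"] by auto
    then show "\<exists>k::nat. \<exists>z\<in>P. g \<otimes> h \<otimes> inv g \<otimes> inv h = c [^] k \<otimes> z"
      using central_elem_comm[OF P_central[OF z(1)], of "c [^] k"] by auto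
  qed
  ultimately have "N \<subseteq> ?S" unfolding derived_def by (rule generate_subgroup_incl[rotated])
  then show ?thesis using assms by blast
qed

text \<open>
  If $c^p = 1$, then \<open>C\<close> is a maximal subgroup of $G'$ that meets \<open>P\<close> trivially.
\<close>

lemma c_pow_ne_one: "c [^] p \<noteq> \<one>"
proof
  assume cp: "c [^] p = \<one>"
  have CP: "z = \<one>" if "z \<in> P" "z \<in> C" for z
  proof -
    obtain k :: nat where k: "z = c [^] k" using \<open>z \<in> C\<close> unfolding C_def by blast
    then obtain l where "k = p * l" using c_pow_P_iff \<open>z \<in> P\<close> by blast
    then have "z = (c [^] p) [^] l" unfolding k by (simp add: nat_pow_pow)
    then show ?thesis by (simp add: cp)
  qed
  have "P \<noteq> {\<one>}" using card_P p_gt by auto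
  then obtain z where z: "z \<in> P" "z \<noteq> \<one>" using subgroup.one_closed[OF P_subgroup] by blast
  have CN: "C \<subseteq> N"
  proof -
    have "c \<in> N" unfolding c_def by (rule commutator_N) simp_all
    then show ?thesis unfolding C_def using subgroup_nat_pow_closed[OF N_subgroup] by blast
  qed
  have "maximal_subgroup C (G\<lparr>carrier := N\<rparr>)"
    unfolding maximal_subgroup_def
  proof (intro conjI allI impI)
    show "subgroup C (G\<lparr>carrier := N\<rparr>)" using subgroup_incl[OF C_subgroup N_subgroup CN] .
    show "C \<noteq> carrier (G\<lparr>carrier := N\<rparr>)" using CP z P_subset_N by auto
    fix H assume H: "subgroup H (G\<lparr>carrier := N\<rparr>) \<and> C \<subseteq> H"
    then have HG: "subgroup H G" and HN: "H \<subseteq> N"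
      using incl_subgroup[OF N_subgroup] subgroup.subset by fastforce+
    show "H = C \<or> H = carrier (G\<lparr>carrier := N\<rparr>)"
    proof (cases "H = C")
      case False
      \<comment> \<open>Removing the power of c from h leaves a non-trivial element of P in H, so H
        contains all of P and with it <c>P = G'.\<close>
      then obtain h where h: "h \<in> H" "h \<notin> C" using H by blast
      then obtain k :: nat and w where w: "w \<in> P" "h = c [^] k \<otimes> w" using N_form HN by blast
      have ck: "c [^] k \<in> C" unfolding C_def by blast
      have "w = inv (c [^] k) \<otimes> h" unfolding w(2) using P_carrier[OF w(1)] by (simp add: m_assoc[symmetric])
      also have "\<dots> \<in> H" using ck h H HG by (simp add: subset_iff subgroup.m_closed subgroup.m_inv_closed)
      finally have "w \<in> H" .
      moreover have "w \<noteq> \<one>" using w ck h by auto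
      ultimately have PH: "P \<subseteq> H" using prime_card_subgroup_subset[OF prime P_subgroup card_P HG w(1)] by blast
      have "N \<subseteq> H"
      proof
        fix d assume "d \<in> N"
        then obtain l :: nat and y where "y \<in> P" "d = c [^] l \<otimes> y" using N_form by blast
        moreover have "c [^] l \<in> C" unfolding C_def by blast
        ultimately show "d \<in> H" using H PH HG by (auto intro: subgroup.m_closed)
      qed
      then show ?thesis using HN by auto
    qed simp
  qed
  then have "P \<subseteq> C" unfolding P_def frattini_def derived_subgroup_def by auto
  then show False using CP z by blast
qed

lemma P_subset_C: "P \<subseteq> C"
proof (rule prime_card_subgroup_subset[OF prime P_subgroup card_P C_subgroup])
  show "c [^] p \<in> P" by (simp add: c_pow_P_iff)
  show "c [^] p \<in> C" by (auto simp: C_def)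
qed (rule c_pow_ne_one)

lemma N_eq: "N = C"
proof
  show "N \<subseteq> C"
  proof
    fix d assume "d \<in> N"
    then obtain l :: nat and y where "y \<in> P" "d = c [^] l \<otimes> y" using N_form by blast
    then show "d \<in> C" using P_subset_C subgroup.m_closed[OF C_subgroup] unfolding C_def by blast
  qed
  have "c \<in> N" unfolding c_def by (rule commutator_N) simp_all
  then show "C \<subseteq> N" unfolding C_def using subgroup_nat_pow_closed[OF N_subgroup] by blast
qed

lemma normal_form:
  assumes "g \<in> carrier G" shows "\<exists>j i. \<exists>d\<in>C. g = b [^] (j::nat) \<otimes> a [^] (i::nat) \<otimes> d"
proof -
  have g: "P #> g \<in> generate Q {P #> a, P #> b}" unfolding Q_gen using assms by simp
  obtain j i k :: nat where
    "P #> g = (P #> b) [^]\<^bsub>Q\<^esub> j \<otimes>\<^bsub>Q\<^esub> (P #> a) [^]\<^bsub>Q\<^esub> i \<otimes>\<^bsub>Q\<^esub> (P #> c) [^]\<^bsub>Q\<^esub> k"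
    using Q.generate_normal_form[OF fin_Q proj_carrier[OF a] proj_carrier[OF b]
        Q_central Q_relations(4) g] by blast
  then have eq: "P #> g = P #> (b [^] j \<otimes> a [^] i \<otimes> c [^] k)" unfolding proj_normal_form .
  have "b [^] j \<otimes> a [^] i \<otimes> c [^] k \<in> carrier G" by simp
  then obtain z where z: "z \<in> P" "g = z \<otimes> (b [^] j \<otimes> a [^] i \<otimes> c [^] k)"
    using eq proj_eq_iff[OF assms] by blast
  then have "g = (b [^] j \<otimes> a [^] i \<otimes> c [^] k) \<otimes> z"
    using central_elem_comm[OF P_central[OF z(1)], of "b [^] j \<otimes> a [^] i \<otimes> c [^] k"] by simp
  then have "g = b [^] j \<otimes> a [^] i \<otimes> (c [^] k \<otimes> z)" using P_carrier[OF z(1)] by (simp add: m_assoc)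
  moreover have "c [^] k \<otimes> z \<in> C"
    using z P_subset_C subgroup.m_closed[OF C_subgroup] unfolding C_def by blast
  ultimately show ?thesis by blast
qed

lemma C_pow: assumes "d \<in> C" shows "\<exists>k::nat. d = c [^] k"
  using assms unfolding C_def by blast

lemma c_commutator:
  assumes "x \<in> carrier G" shows "\<exists>s\<in>P. c \<otimes> x = x \<otimes> c \<otimes> s"
  using mult_commutator[OF c_carrier assms] commutator_P[OF _ assms, of c] c_C N_eq by blast

section \<open>Generating pairs of G\<close>

lemma generate_eq_carrier:
  assumes x: "x \<in> carrier G" and y: "y \<in> carrier G"
    and ab: "a \<in> generate G {x, y}" "b \<in> generate G {x, y}"
  shows "generate G {x, y} = carrier G"
proof
  let ?K = "generate G {x, y}"
  have K: "subgroup ?K G" using x y by (intro generate_is_subgroup) auto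
  then show "?K \<subseteq> carrier G" by (rule subgroup.subset)
  have c: "c \<in> ?K" unfolding c_def commutator_def
    by (intro subgroup.m_closed[OF K] subgroup.m_inv_closed[OF K] ab)
  show "carrier G \<subseteq> ?K"
  proof
    fix g assume "g \<in> carrier G"
    then obtain j i :: nat and d where d: "d \<in> C" "g = b [^] j \<otimes> a [^] i \<otimes> d"
      using normal_form by blast
    moreover obtain k :: nat where "d = c [^] k" using C_pow d by blast
    ultimately show "g \<in> ?K" using subgroup_nat_pow_closed[OF K] ab c by (simp add: subgroup.m_closed[OF K])
  qed
qed

text \<open>The quotient G/G' is abelian, so \<open>generate_normal_form\<close> applies there with
  trivial t. Lifting to G costs a factor from G' = C, which stands in front.\<close>

lemma two_generator_form:
  assumes x: "x \<in> carrier G" and y: "y \<in> carrier G" and gen: "generate G {x, y} = carrier G"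
    and g: "g \<in> carrier G"
  shows "\<exists>j i. \<exists>d\<in>C. g = d \<otimes> (y [^] (j::nat) \<otimes> x [^] (i::nat))"
proof -
  let ?A = "G Mod N"
  interpret A: comm_group ?A by (rule derived_quot_is_comm_group)
  interpret h: group_hom G ?A "\<lambda>g. N #> g"
    using normal.r_coset_hom_Mod[OF N_normal]
    by (intro group_hom.intro group_hom_axioms.intro is_group A.is_group)
  have fA: "finite (carrier ?A)" unfolding carrier_FactGroup using fin by simp
  have cA: "N #> g \<in> carrier ?A" if "g \<in> carrier G" for g using that h.hom_closed by blast
  have "generate ?A {N #> x, N #> y} = (\<lambda>g. N #> g) ` carrier G"
    using h.generate_img[of "{x, y}"] x y gen by simp
  then have gA: "N #> g \<in> generate ?A {N #> x, N #> y}" using g by blast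
  have one: "A.central_elem \<one>\<^bsub>?A\<^esub>" unfolding A.central_elem_def
    using A.one_closed A.l_one A.r_one by simp
  have "(N #> x) \<otimes>\<^bsub>?A\<^esub> (N #> y) = (N #> y) \<otimes>\<^bsub>?A\<^esub> (N #> x) \<otimes>\<^bsub>?A\<^esub> \<one>\<^bsub>?A\<^esub>"
    using A.m_comm[OF cA[OF x] cA[OF y]] A.r_one[OF A.m_closed[OF cA[OF y] cA[OF x]]] by (simp only:)
  then obtain j i k :: nat where
    "N #> g = (N #> y) [^]\<^bsub>?A\<^esub> j \<otimes>\<^bsub>?A\<^esub> (N #> x) [^]\<^bsub>?A\<^esub> i \<otimes>\<^bsub>?A\<^esub> \<one>\<^bsub>?A\<^esub> [^]\<^bsub>?A\<^esub> k"
    using A.generate_normal_form[OF fA cA[OF x] cA[OF y] one _ gA] by blast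
  also have "\<dots> = (N #> y) [^]\<^bsub>?A\<^esub> j \<otimes>\<^bsub>?A\<^esub> (N #> x) [^]\<^bsub>?A\<^esub> i"
    by (simp only: A.nat_pow_one A.r_one A.m_closed A.nat_pow_closed cA[OF x] cA[OF y])
  also have "\<dots> = N #> (y [^] j \<otimes> x [^] i)"
    by (simp only: h.hom_mult h.hom_nat_pow x y nat_pow_closed)
  finally have "N #> g = N #> (y [^] j \<otimes> x [^] i)" .
  then have "g \<in> N #> (y [^] j \<otimes> x [^] i)" using rcos_self[OF g N_subgroup] by simp
  then show ?thesis unfolding N_eq r_coset_def by blast
qed

text \<open>
  The commutators of the group generated by \<open>x\<close> and \<open>y\<close> lie in \<open>P\<close>, but \<open>c\<close> does not.
\<close>

lemma generate_ne_carrier: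
  assumes x: "x \<in> carrier G" and y: "y \<in> carrier G" and t: "t \<in> P"
    and xy: "x \<otimes> y = y \<otimes> x \<otimes> t"
  shows "generate G {x, y} \<noteq> carrier G"
proof
  assume gen: "generate G {x, y} = carrier G"
  \<comment> \<open>The commutator c is u v u^(-1) v^(-1) for u = a^(-1) and v = b^(-1), the shape
    that \<open>normal_form_commutator\<close> treats.\<close>
  obtain k :: nat where "inv a \<otimes> inv b \<otimes> inv (inv a) \<otimes> inv (inv b) = t [^] k"
    using normal_form_commutator[OF fin p_gt(1) x y P_central[OF t] xy P_pow[OF t], of "inv a" "inv b"]
    unfolding gen by auto
  then have "c = t [^] k" by (simp add: c_def commutator_def)
  also have "\<dots> \<in> P" using subgroup_nat_pow_closed[OF P_subgroup t] .
  finally have "c [^] (1::nat) \<in> P" by simp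
  then show False using c_pow_P_iff[of 1] p_gt by simp
qed

text \<open>
  $G/P$ is itself an $\mathcal{A}_1$-group, so the image of \<open>H\<close> in it is abelian with two generators
  and has at most $p^2$ elements of exponent \<open>p\<close>; the three given elements would generate $p^3$ of them.
\<close>

lemma A1_subgroup_omits_exponent_p_elements:
  assumes A1: "A1_subgroup p H G" and PH: "P \<subseteq> H" and HG: "H \<noteq> carrier G"
    and abc: "a [^] (p ^ (n - 1)) \<in> H" "b [^] (p ^ (m - 1)) \<in> H" "c \<in> H"
  shows False
proof -
  have H: "subgroup H G" using A1 by (simp add: A1_subgroup_def)
  have Hc: "h \<in> carrier G" if "h \<in> H" for h using subgroup.mem_carrier[OF H that] .
  obtain u v where uv: "u \<in> H" "v \<in> H" "generate G {u, v} = H"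
    using A1_subgroup_two_generated[OF A1] by blast
  let ?H = "proj ` H" let ?R = "Q\<lparr>carrier := ?H\<rparr>"
  have Hbar: "subgroup ?H Q" using proj.subgroup_img_is_subgroup[OF H] .
  have Hbar_ne: "?H \<noteq> carrier Q"
  proof
    assume eq: "?H = carrier Q"
    \<comment> \<open>H contains P, so it is the full preimage of its image.\<close>
    have "g \<in> H" if g: "g \<in> carrier G" for g
    proof -
      have "P #> g \<in> ?H" using g unfolding eq by simp
      then obtain h where h: "h \<in> H" "P #> g = P #> h" by blast
      then obtain z where "z \<in> P" "g = z \<otimes> h" using proj_eq_iff[OF g Hc] by blast
      then show ?thesis using h PH subgroup.m_closed[OF H] by blast
    qed
    then show False using HG subgroup.subset[OF H] by blast
  qed
  obtain q where q: "order Q = p ^ q" using order_Q by blast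
  have comm: "r \<otimes>\<^bsub>Q\<^esub> s = s \<otimes>\<^bsub>Q\<^esub> r" if "r \<in> ?H" "s \<in> ?H" for r s
  proof (rule ccontr)
    assume "r \<otimes>\<^bsub>Q\<^esub> s \<noteq> s \<otimes>\<^bsub>Q\<^esub> r"
    moreover have "?H \<subseteq> generate Q {P #> a, P #> b}"
      unfolding Q_gen by (rule subgroup.subset[OF Hbar])
    ultimately have "generate Q {P #> a, P #> b} \<subseteq> ?H"
      using Q.noncommuting_imp_generate_subset[OF prime q proj_carrier[OF a] proj_carrier[OF b]
          Q_central Q_relations(4,3) Hbar _ that] by blast
    then show False using Hbar_ne subgroup.subset[OF Hbar] unfolding Q_gen by blast
  qed
  interpret R: comm_group ?R using Q.comm_group_subgroupI[OF Hbar comm] .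
  have finR: "finite (carrier ?R)"
    using finite_subset[OF subgroup.subset[OF Hbar] fin_Q] by simp
  have "generate Q {P #> u, P #> v} = ?H"
    using proj.generate_img[of "{u, v}"] uv Hc by simp
  then have genR: "carrier ?R \<subseteq> generate ?R {P #> u, P #> v}"
    using Q.generate_consistent[OF _ Hbar, of "{P #> u, P #> v}"] uv by simp
  then have le: "card {w \<in> carrier ?R. w [^]\<^bsub>?R\<^esub> p = \<one>\<^bsub>?R\<^esub>} \<le> p ^ 2"
    using uv by (intro R.card_exponent_p_le[OF R.comm_group_axioms finR p_gt(1) _ _ genR]) simp_all
  define \<alpha> \<beta> \<gamma> where "\<alpha> = P #> (a [^] (p ^ (n - 1)))" and "\<beta> = P #> (b [^] (p ^ (m - 1)))" and "\<gamma> = P #> c"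
  have mem: "\<alpha> \<in> carrier ?R" "\<beta> \<in> carrier ?R" "\<gamma> \<in> carrier ?R"
    using abc by (simp_all add: \<alpha>_def \<beta>_def \<gamma>_def)
  have ab: "\<alpha> = (P #> a) [^]\<^bsub>Q\<^esub> (p ^ (n - 1))" "\<beta> = (P #> b) [^]\<^bsub>Q\<^esub> (p ^ (m - 1))"
    by (simp_all only: \<alpha>_def \<beta>_def proj.hom_nat_pow a b)
  have pn: "p ^ (n - 1) * p = p ^ n" "p ^ (m - 1) * p = p ^ m"
    using power_minus_mult[of n p] power_minus_mult[of m p] m_ge n_ge by simp_all
  have powR: "r [^]\<^bsub>?R\<^esub> (k::nat) = r [^]\<^bsub>Q\<^esub> k" for r k
    using Q.nat_pow_consistent[of r k ?H] by simp
  have one: "\<alpha> [^]\<^bsub>?R\<^esub> p = \<one>\<^bsub>?R\<^esub>" "\<beta> [^]\<^bsub>?R\<^esub> p = \<one>\<^bsub>?R\<^esub>" "\<gamma> [^]\<^bsub>?R\<^esub> p = \<one>\<^bsub>?R\<^esub>"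
    using Q_relations(1,2,3) unfolding powR ab
    by (simp_all only: Q.nat_pow_pow proj_carrier a b pn \<gamma>_def) simp_all
  let ?F = "\<lambda>(j, i, k). \<beta> [^]\<^bsub>?R\<^esub> j \<otimes>\<^bsub>?R\<^esub> \<alpha> [^]\<^bsub>?R\<^esub> i \<otimes>\<^bsub>?R\<^esub> \<gamma> [^]\<^bsub>?R\<^esub> k"
  let ?B = "{..<p} \<times> {..<p} \<times> {..<p}"
  have F: "?F (j, i, k) = (P #> b) [^]\<^bsub>Q\<^esub> (p ^ (m - 1) * j) \<otimes>\<^bsub>Q\<^esub> (P #> a) [^]\<^bsub>Q\<^esub> (p ^ (n - 1) * i)
      \<otimes>\<^bsub>Q\<^esub> (P #> c) [^]\<^bsub>Q\<^esub> k" for j i k :: nat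
    unfolding prod.case powR ab \<gamma>_def by (simp only: Q.nat_pow_pow proj_carrier a b) simp
  have inj: "inj_on ?F ?B"
  proof (rule inj_onI)
    fix x y assume B: "x \<in> ?B" "y \<in> ?B" and f: "?F x = ?F y"
    obtain j i k r s l where xy: "x = (j, i, k)" "y = (r, s, l)" by (cases x; cases y)
    \<comment> \<open>Multiplying exponents below p by p^(m-1) or p^(n-1) stays in the range where
      \<open>Q_inj\<close> separates normal forms.\<close>
    have "p ^ (m - 1) * j < p ^ m" "p ^ (m - 1) * r < p ^ m"
      "p ^ (n - 1) * i < p ^ n" "p ^ (n - 1) * s < p ^ n" "k < p" "l < p"
      using B p_gt unfolding pn[symmetric] by (simp_all add: xy)
    then have "(p ^ (m - 1) * j, p ^ (n - 1) * i, k) = (p ^ (m - 1) * r, p ^ (n - 1) * s, l)"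
      using f unfolding xy F by (intro inj_onD[OF Q_inj]) simp_all
    then show "x = y" using p_gt by (simp add: xy)
  qed
  have img: "?F ` ?B \<subseteq> {w \<in> carrier ?R. w [^]\<^bsub>?R\<^esub> p = \<one>\<^bsub>?R\<^esub>}"
  proof -
    have pw: "(r [^]\<^bsub>?R\<^esub> (k::nat)) [^]\<^bsub>?R\<^esub> p = \<one>\<^bsub>?R\<^esub>"
      if "r \<in> carrier ?R" "r [^]\<^bsub>?R\<^esub> p = \<one>\<^bsub>?R\<^esub>" for r k
    proof -
      have "(r [^]\<^bsub>?R\<^esub> k) [^]\<^bsub>?R\<^esub> p = (r [^]\<^bsub>?R\<^esub> p) [^]\<^bsub>?R\<^esub> k"
        unfolding R.nat_pow_pow[OF that(1)] by (simp only: mult.commute[of k p])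
      then show ?thesis unfolding that(2) by (simp only: R.nat_pow_one)
    qed
    have "?F (j, i, k) [^]\<^bsub>?R\<^esub> p = \<one>\<^bsub>?R\<^esub>" for j i k :: nat
      unfolding prod.case
      by (simp only: R.nat_pow_distrib R.m_closed R.nat_pow_closed mem pw[OF mem(1) one(1)]
          pw[OF mem(2) one(2)] pw[OF mem(3) one(3)] R.l_one R.one_closed)
    moreover have "?F (j, i, k) \<in> carrier ?R" for j i k :: nat
      unfolding prod.case by (intro R.m_closed R.nat_pow_closed mem)
    ultimately show ?thesis by blast
  qed
  have "finite {w \<in> carrier ?R. w [^]\<^bsub>?R\<^esub> p = \<one>\<^bsub>?R\<^esub>}" using finR by simp
  from card_inj_on_le[OF inj img this] le have "card ?B \<le> p ^ 2" by (rule le_trans)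
  then have "p ^ 3 \<le> p ^ 2" by (simp only: card_cartesian_product card_lessThan power3_eq_cube mult.assoc)
  then show False using power_le_imp_le_exp[of p 3 2] p_gt by linarith
qed

section \<open>An A1-subgroup of index at most p^2\<close>

lemma pow_mem_C: "d \<in> C \<Longrightarrow> d [^] p \<in> P"
proof -
  assume "d \<in> C"
  then obtain k :: nat where k: "d = c [^] k" using C_pow by blast
  have "d [^] p = c [^] (p * k)" unfolding k by (simp add: nat_pow_pow mult.commute)
  then show ?thesis by (simp only: c_pow_P_iff dvd_triv_left)
qed

text \<open>The element in the last hypothesis is [x,y^p], a non-trivial element of P. It lies in
  the generated subgroup, which therefore contains P, so the p^2 products c^k y^j with k, j < p meet
  all cosets. The commutator d is kept general to allow c^(-1) for the pair (b,a).\<close>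

lemma A1_subgroup_two_generated_pow:
  assumes x: "x \<in> carrier G" and y: "y \<in> carrier G" and gen: "generate G {x, y} = carrier G"
    and d: "d \<in> C" and s: "s \<in> P"
    and xy: "x \<otimes> y = y \<otimes> x \<otimes> d" and dy: "d \<otimes> y = y \<otimes> d \<otimes> s"
    and t: "d [^] p \<otimes> s [^] (p choose 2) \<noteq> \<one>"
  shows "A1_subgroup p (generate G {x, y [^] p}) G"
    and "order G \<le> p ^ 2 * card (generate G {x, y [^] p})"
    and "generate G {x, y [^] p} \<noteq> carrier G"
proof -
  let ?K = "generate G {x, y [^] p}"
  define t where "t = d [^] p \<otimes> s [^] (p choose 2)"
  have tP: "t \<in> P" unfolding t_def
    using pow_mem_C[OF d] subgroup_nat_pow_closed[OF P_subgroup s] subgroup.m_closed[OF P_subgroup] by blast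
  have [simp]: "d \<in> carrier G" "s \<in> carrier G" "t \<in> carrier G"
    using d s tP P_carrier subgroup.mem_carrier[OF C_subgroup] by blast+
  note [simp] = x y
  have yp [simp]: "y [^] p \<in> carrier G" by simp
  have xyp: "x \<otimes> y [^] p = y [^] p \<otimes> x \<otimes> t"
    using mult_pow_of_commutator[OF x y _ P_central[OF s] xy dy, of p] by (simp add: t_def m_assoc)
  show "A1_subgroup p ?K G"
    using A1_subgroup_generate[OF prime ord x yp P_central[OF tP] xyp P_pow[OF tP]] t t_def by simp
  show "?K \<noteq> carrier G" using generate_ne_carrier[OF x yp tP xyp] .
  have K: "subgroup ?K G" by (intro generate_is_subgroup) simp
  have xK: "x \<in> ?K" and ypK: "y [^] p \<in> ?K" by (auto intro: generate.incl)
  have "t = inv (y [^] p \<otimes> x) \<otimes> (x \<otimes> y [^] p)"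
    unfolding xyp by (simp add: m_assoc[symmetric]) (simp add: m_assoc)
  also have "\<dots> \<in> ?K" by (intro subgroup.m_closed[OF K] subgroup.m_inv_closed[OF K] xK ypK)
  finally have tK: "t \<in> ?K" .
  have PK: "P \<subseteq> ?K"
    using prime_card_subgroup_subset[OF prime P_subgroup card_P K tP tK] t t_def by simp
  have cpP: "c [^] p \<in> P" by (simp add: c_pow_P_iff)
  let ?S = "(\<lambda>(k, j). c [^] k \<otimes> y [^] j) ` ({..<p} \<times> {..<p})"
  have "carrier G \<subseteq> (\<lambda>(s, k). s \<otimes> k) ` (?S \<times> ?K)"
  proof
    fix g assume "g \<in> carrier G"
    then obtain j i :: nat and d' where d': "d' \<in> C" "g = d' \<otimes> (y [^] j \<otimes> x [^] i)"
      using two_generator_form[OF x y gen] by blast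
    obtain k :: nat where k: "d' = c [^] k" using C_pow d' by blast
    \<comment> \<open>The part of c^k beyond k mod p is a power of c^p, hence central and in ?K; it
      can be moved to the right of the power of y.\<close>
    define z where "z = (c [^] p) [^] (k div p)"
    have zP: "z \<in> P" unfolding z_def using subgroup_nat_pow_closed[OF P_subgroup cpP] .
    note [simp] = P_carrier[OF zP]
    have "g = c [^] (k mod p) \<otimes> z \<otimes> (y [^] (j mod p) \<otimes> (y [^] p) [^] (j div p) \<otimes> x [^] i)"
      unfolding d'(2) k z_def using nat_pow_mod_split[of c k p] nat_pow_mod_split[of y j p] by simp
    also have "\<dots> = c [^] (k mod p) \<otimes> (z \<otimes> y [^] (j mod p)) \<otimes> ((y [^] p) [^] (j div p) \<otimes> x [^] i)"
      by (simp add: m_assoc)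
    also have "z \<otimes> y [^] (j mod p) = y [^] (j mod p) \<otimes> z"
      using central_elem_comm[OF P_central[OF zP]] by simp
    also have "c [^] (k mod p) \<otimes> (y [^] (j mod p) \<otimes> z) \<otimes> ((y [^] p) [^] (j div p) \<otimes> x [^] i)
      = (c [^] (k mod p) \<otimes> y [^] (j mod p)) \<otimes> (z \<otimes> ((y [^] p) [^] (j div p) \<otimes> x [^] i))"
      by (simp add: m_assoc)
    finally have "g = (c [^] (k mod p) \<otimes> y [^] (j mod p)) \<otimes> (z \<otimes> ((y [^] p) [^] (j div p) \<otimes> x [^] i))" .
    moreover have "z \<otimes> ((y [^] p) [^] (j div p) \<otimes> x [^] i) \<in> ?K"
      using zP PK subgroup_nat_pow_closed[OF K xK] subgroup_nat_pow_closed[OF K ypK] subgroup.m_closed[OF K] by blast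
    moreover have "c [^] (k mod p) \<otimes> y [^] (j mod p) \<in> ?S" using p_gt by force
    ultimately show "g \<in> (\<lambda>(s, k). s \<otimes> k) ` (?S \<times> ?K)" by blast
  qed
  then have "order G \<le> card ?S * card ?K"
    using finite_subset[OF subgroup.subset[OF K] fin] by (intro order_le_of_cover) auto
  also have "card ?S \<le> p ^ 2"
    using card_image_le[of "{..<p} \<times> {..<p}" "\<lambda>(k, j). c [^] k \<otimes> y [^] j"]
    by (simp add: card_cartesian_product power2_eq_square)
  finally show "order G \<le> p ^ 2 * card ?K" by simp
qed

lemma P_two_eq:
  assumes "p = 2" "z \<in> P" "z \<noteq> \<one>" "w \<in> P" "w \<noteq> \<one>" shows "z = w"
proof (rule ccontr)
  assume "z \<noteq> w"
  then have "card {\<one>, z, w} = 3" using assms by simp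
  moreover have "{\<one>, z, w} \<subseteq> P" using assms subgroup.one_closed[OF P_subgroup] by blast
  moreover have "finite P" using card_P p_gt by (metis card.infinite less_irrefl)
  ultimately have "3 \<le> card P" by (metis card_mono)
  then show False using card_P assms by simp
qed

lemma ab_eq: "a \<otimes> b = b \<otimes> a \<otimes> c"
  using mult_commutator[OF a b] by (simp add: c_def)

lemma gen_ab: "generate G {a, b} = carrier G"
  by (rule generate_eq_carrier) (auto intro: generate.incl)

lemma gen_a_ab: "generate G {a, a \<otimes> b} = carrier G"
proof (rule generate_eq_carrier)
  have K: "subgroup (generate G {a, a \<otimes> b}) G" by (intro generate_is_subgroup) simp
  show aK: "a \<in> generate G {a, a \<otimes> b}" by (auto intro: generate.incl)
  have "a \<otimes> b \<in> generate G {a, a \<otimes> b}" by (auto intro: generate.incl)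
  then have "inv a \<otimes> (a \<otimes> b) \<in> generate G {a, a \<otimes> b}"
    by (rule subgroup.m_closed[OF K subgroup.m_inv_closed[OF K aK]])
  moreover have "inv a \<otimes> (a \<otimes> b) = b" by (simp add: m_assoc[symmetric])
  ultimately show "b \<in> generate G {a, a \<otimes> b}" by metis
qed simp_all

lemma gen_ab_b: "generate G {a \<otimes> b, b} = carrier G"
proof (rule generate_eq_carrier)
  have K: "subgroup (generate G {a \<otimes> b, b}) G" by (intro generate_is_subgroup) simp
  show bK: "b \<in> generate G {a \<otimes> b, b}" by (auto intro: generate.incl)
  have "a \<otimes> b \<in> generate G {a \<otimes> b, b}" by (auto intro: generate.incl)
  then have "(a \<otimes> b) \<otimes> inv b \<in> generate G {a \<otimes> b, b}"
    by (rule subgroup.m_closed[OF K _ subgroup.m_inv_closed[OF K bK]])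
  moreover have "(a \<otimes> b) \<otimes> inv b = a" by (simp add: m_assoc)
  ultimately show "a \<in> generate G {a \<otimes> b, b}" by metis
qed simp_all

lemma c_mult_ab:
  assumes "s \<in> P" "r \<in> P" "c \<otimes> a = a \<otimes> c \<otimes> s" "c \<otimes> b = b \<otimes> c \<otimes> r"
  shows "c \<otimes> (a \<otimes> b) = (a \<otimes> b) \<otimes> c \<otimes> (r \<otimes> s)"
proof -
  note [simp] = P_carrier[OF assms(1)] P_carrier[OF assms(2)]
  have "c \<otimes> (a \<otimes> b) = (a \<otimes> c \<otimes> s) \<otimes> b" using assms(3) by (simp add: m_assoc[symmetric])
  also have "\<dots> = a \<otimes> c \<otimes> (s \<otimes> b)" by (simp add: m_assoc)
  also have "s \<otimes> b = b \<otimes> s" using central_elem_comm[OF P_central[OF assms(1)]] by simp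
  also have "a \<otimes> c \<otimes> (b \<otimes> s) = a \<otimes> (c \<otimes> b) \<otimes> s" by (simp add: m_assoc)
  also have "\<dots> = (a \<otimes> b) \<otimes> c \<otimes> (r \<otimes> s)" unfolding assms(4) by (simp add: m_assoc)
  finally show ?thesis .
qed

text \<open>Let s = [c,a] and r = [c,b]. If the binomial term in r vanishes, as for odd p, then
  [a,b^p] = c^p \<noteq> 1. Otherwise p = 2 and r \<noteq> 1. If s = 1, then a commutes with c and
  the pair (b,a) works. If s \<noteq> 1, then r = s in the group P of order 2, so [c,ab] = r s = 1
  and the pair (a,ab) works.\<close>

lemma ex_A1_subgroup:
  obtains K where "A1_subgroup p K G" "order G \<le> p ^ 2 * card K" "K \<noteq> carrier G"
proof -
  obtain s where s: "s \<in> P" "c \<otimes> a = a \<otimes> c \<otimes> s" using c_commutator[OF a] by blast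
  obtain r where r: "r \<in> P" "c \<otimes> b = b \<otimes> c \<otimes> r" using c_commutator[OF b] by blast
  note [simp] = P_carrier[OF s(1)] P_carrier[OF r(1)]
  have cp: "c [^] p \<noteq> \<one>" by (rule c_pow_ne_one)
  consider (1) "r [^] (p choose 2) = \<one>" | (2) "p = 2" "s = \<one>" | (3) "p = 2" "s \<noteq> \<one>" "r \<noteq> \<one>"
  proof (cases "p = 2")
    case True then show thesis using that by auto
  next
    case False
    then have "p > 2" using p_gt by simp
    then have "p dvd (p choose 2)" using prime p_gt by (intro dvd_choose_prime) simp_all
    then obtain q where "p choose 2 = p * q" by blast
    then have "r [^] (p choose 2) = (r [^] p) [^] q" by (simp add: nat_pow_pow)
    then show thesis using that P_pow[OF r(1)] by simp
  qed
  then show thesis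
  proof cases
    case 1
    have "c [^] p \<otimes> r [^] (p choose 2) \<noteq> \<one>" using 1 cp by simp
    from A1_subgroup_two_generated_pow[OF a b gen_ab c_C r(1) ab_eq r(2) this] show thesis using that by blast
  next
    case 2
    have gen_ba: "generate G {b, a} = carrier G" using gen_ab by (simp add: insert_commute)
    have iC: "inv c \<in> C" using c_C subgroup.m_inv_closed[OF C_subgroup] by blast
    have ba: "b \<otimes> a = a \<otimes> b \<otimes> inv c" unfolding ab_eq by (simp add: m_assoc)
    have "c \<otimes> a = a \<otimes> c" using s(2) 2 by simp
    then have "inv c \<otimes> (c \<otimes> a) \<otimes> inv c = inv c \<otimes> (a \<otimes> c) \<otimes> inv c" by (simp only:)
    moreover have "inv c \<otimes> (c \<otimes> a) \<otimes> inv c = a \<otimes> inv c" by (simp add: m_assoc[symmetric])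
    moreover have "inv c \<otimes> (a \<otimes> c) \<otimes> inv c = inv c \<otimes> a" by (simp add: m_assoc)
    ultimately have ca: "inv c \<otimes> a = a \<otimes> inv c \<otimes> \<one>" by simp
    have "inv c [^] p \<otimes> \<one> [^] (p choose 2) \<noteq> \<one>"
      using cp by (simp add: nat_pow_inv inv_eq_1_iff)
    from A1_subgroup_two_generated_pow[OF b a gen_ba iC subgroup.one_closed[OF P_subgroup] ba ca this]
    show thesis using that by blast
  next
    case 3
    have rs: "r = s" using P_two_eq 3 r(1) s(1) by blast
    have "r \<otimes> s = \<one>" unfolding rs using P_pow[OF s(1)] 3 by (simp add: numeral_2_eq_2)
    then have cab: "c \<otimes> (a \<otimes> b) = (a \<otimes> b) \<otimes> c \<otimes> \<one>" using c_mult_ab[OF s(1) r(1) s(2) r(2)] by simp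
    have "a \<otimes> (a \<otimes> b) = a \<otimes> (b \<otimes> a \<otimes> c)" by (simp only: ab_eq)
    then have aab: "a \<otimes> (a \<otimes> b) = (a \<otimes> b) \<otimes> a \<otimes> c" by (simp only: m_assoc m_closed a b c_carrier)
    have "c [^] p \<otimes> \<one> [^] (p choose 2) \<noteq> \<one>" using cp by simp
    from A1_subgroup_two_generated_pow[OF a _ gen_a_ab c_C subgroup.one_closed[OF P_subgroup] aab cab this]
    show thesis using that by simp
  qed
qed

section \<open>The case m \<ge> 2\<close>

lemma A1_index_ne_prime:
  assumes m: "2 \<le> m" and A1: "A1_subgroup p H G" shows "subgroup_index G H \<noteq> p"
proof
  assume idx: "subgroup_index G H = p"
  have H: "subgroup H G" using A1 by (simp add: A1_subgroup_def)
  have NH: "N \<subseteq> H" and pow: "\<And>g. g \<in> carrier G \<Longrightarrow> g [^] p \<in> H"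
    using prime_index_derived_subset[OF prime ord H idx] by blast+
  \<comment> \<open>For k \<ge> 2 this is a power of g^p, and p-th powers lie in H. It applies to
    both a and b exactly because n \<ge> m \<ge> 2.\<close>
  have pp: "g [^] (p ^ (k - 1)) \<in> H" if "g \<in> carrier G" "2 \<le> k" for g k
  proof -
    have "p ^ (k - 1) = p * p ^ (k - 2)" using that(2) by (metis One_nat_def Suc_diff_Suc Suc_le_lessD numeral_2_eq_2 power_Suc)
    then have "g [^] (p ^ (k - 1)) = (g [^] p) [^] (p ^ (k - 2))" using that(1) by (simp add: nat_pow_pow)
    then show ?thesis using subgroup_nat_pow_closed[OF H pow[OF that(1)]] by simp
  qed
  show False
  proof (rule A1_subgroup_omits_exponent_p_elements[OF A1])
    show "P \<subseteq> H" using NH P_subset_N by blast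
    show "H \<noteq> carrier G"
      using idx subgroup_index_mult_card[OF H] p_gt fin order_gt_0_iff_finite by (auto simp: order_def)
    show "a [^] (p ^ (n - 1)) \<in> H" "b [^] (p ^ (m - 1)) \<in> H" using pp m n_ge by simp_all
    show "c \<in> H" using NH N_eq c_C by blast
  qed
qed

text \<open>\<open>ex_A1_subgroup\<close> gives a proper non-abelian subgroup, so G is not minimal
  non-abelian itself.\<close>

lemma A1_proper:
  assumes "A1_subgroup p H G" shows "H \<noteq> carrier G"
proof
  assume eq: "H = carrier G"
  obtain K where K: "A1_subgroup p K G" "K \<noteq> carrier G" using ex_A1_subgroup by blast
  then have "subgroup K G" "\<not> comm_group (G\<lparr>carrier := K\<rparr>)"
    by (auto simp: A1_subgroup_def A1_group_def)
  then show False using assms K(2) by (auto simp: A1_subgroup_def A1_group_def eq)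
qed

lemma min_A1_index_eq:
  assumes m: "2 \<le> m" shows "min_A1_index p G = p ^ 2"
proof -
  have card_pos: "card H > 0" if "subgroup H G" for H
    using that fin by (metis subgroup.finite_imp_card_positive)
  have ge: "p ^ 2 \<le> subgroup_index G H" if A1: "A1_subgroup p H G" for H
  proof -
    have H: "subgroup H G" using A1 by (simp add: A1_subgroup_def)
    have "subgroup_index G H dvd p ^ e"
      using subgroup_index_mult_card[OF H] ord by (metis dvd_triv_left)
    then obtain k where k: "subgroup_index G H = p ^ k" using prime by (auto simp: divides_primepow_nat)
    have "k \<noteq> 0"
    proof
      assume "k = 0"
      then have "card H = card (carrier G)" using subgroup_index_mult_card[OF H] k by (simp add: order_def)
      then show False using A1_proper[OF A1] card_subset_eq[OF fin subgroup.subset[OF H]] by blast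
    qed
    moreover have "k \<noteq> 1" using A1_index_ne_prime[OF m A1] k by auto
    ultimately have "2 \<le> k" by simp
    then show ?thesis unfolding k using p_gt by (intro power_increasing) auto
  qed
  obtain K where K: "A1_subgroup p K G" "order G \<le> p ^ 2 * card K" using ex_A1_subgroup by blast
  have KG: "subgroup K G" using K by (simp add: A1_subgroup_def)
  have "subgroup_index G K * card K \<le> p ^ 2 * card K" using subgroup_index_mult_card[OF KG] K by simp
  then have "subgroup_index G K \<le> p ^ 2" using card_pos[OF KG] by simp
  then have "subgroup_index G K = p ^ 2" using ge[OF K(1)] by simp
  then show ?thesis unfolding min_A1_index_def
    using ge K(1) by (intro Least_equality) auto
qed

lemma I_min_eq: "2 \<le> m \<Longrightarrow> I_min p G = 2"
  unfolding I_min_def min_A1_index_eq using p_gt by (intro the_equality) (auto simp: power_inject_exp)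

section \<open>The case m = 1\<close>

lemma m_one:
  assumes m: "m = 1" shows "p = 2" "c \<otimes> b = b \<otimes> c \<otimes> c [^] (2::nat)"
proof -
  obtain r where r: "r \<in> P" "c \<otimes> b = b \<otimes> c \<otimes> r" using c_commutator[OF b] by blast
  note [simp] = P_carrier[OF r(1)]
  have bp: "b [^] p \<in> P" using b_pow_P m by simp
  have "a \<otimes> b [^] p = b [^] p \<otimes> a \<otimes> (c [^] p \<otimes> r [^] (p choose 2))"
    using mult_pow_of_commutator[OF a b c_carrier P_central[OF r(1)] ab_eq r(2), of p] by (simp add: m_assoc)
  moreover have "a \<otimes> b [^] p = b [^] p \<otimes> a" using central_elem_comm[OF P_central[OF bp] a] by simp
  ultimately have cr: "c [^] p \<otimes> r [^] (p choose 2) = \<one>" by simp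
  show p2: "p = 2"
  proof (rule ccontr)
    assume "p \<noteq> 2"
    then have "p > 2" using p_gt by simp
    then have "p dvd (p choose 2)" using prime p_gt by (intro dvd_choose_prime) simp_all
    then obtain q where "p choose 2 = p * q" by blast
    then have "r [^] (p choose 2) = (r [^] p) [^] q" by (simp add: nat_pow_pow)
    then show False using cr P_pow[OF r(1)] c_pow_ne_one by simp
  qed
  \<comment> \<open>For p = 2 the binomial coefficient is 1 and the relation reads c^2 r = 1. Both
    factors are non-trivial elements of a group of order 2, so they agree.\<close>
  have "r \<noteq> \<one>" using cr c_pow_ne_one by auto
  moreover have "c [^] (2::nat) \<in> P" "c [^] (2::nat) \<noteq> \<one>" using p2 c_pow_P_iff[of 2] c_pow_ne_one by auto
  ultimately have "r = c [^] (2::nat)" using P_two_eq[OF p2 r(1)] by blast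
  then show "c \<otimes> b = b \<otimes> c \<otimes> c [^] (2::nat)" using r(2) by simp
qed

text \<open>As m = 1, b^2 lies in P and thus in <c>, so 1 and b represent all cosets of
  <c,x>.\<close>

lemma order_le_two_generate:
  assumes m: "m = 1" and x: "x \<in> carrier G" and gen: "generate G {x, b} = carrier G"
  shows "order G \<le> 2 * card (generate G {c, x})"
proof -
  let ?L = "generate G {c, x}"
  have p2: "p = 2" using m_one[OF m] by simp
  have L: "subgroup ?L G" using x by (intro generate_is_subgroup) simp
  have cL: "c \<in> ?L" and xL: "x \<in> ?L" by (auto intro: generate.incl)
  have CL: "C \<subseteq> ?L" unfolding C_def using subgroup_nat_pow_closed[OF L cL] by blast
  let ?S = "(\<lambda>j. b [^] j) ` {..<p}"
  have "carrier G \<subseteq> (\<lambda>(s, k). s \<otimes> k) ` (?S \<times> ?L)"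
  proof
    fix g assume "g \<in> carrier G"
    then obtain j i :: nat and d where d: "d \<in> C" "g = d \<otimes> (b [^] j \<otimes> x [^] i)"
      using two_generator_form[OF x b gen] by blast
    note [simp] = x subgroup.mem_carrier[OF C_subgroup d(1)]
    \<comment> \<open>The power of b must stand first to serve as coset representative; d moves past
      it by conjugation and stays in \<open>C\<close>, which is normal as the derived
      subgroup.\<close>
    define d' where "d' = inv (b [^] j) \<otimes> d \<otimes> b [^] j"
    have d'C: "d' \<in> C"
      using normal.inv_op_closed1[OF N_normal, of "b [^] j" d] d(1) N_eq by (simp add: d'_def)
    note [simp] = subgroup.mem_carrier[OF C_subgroup d'C]
    have "g = b [^] j \<otimes> d' \<otimes> x [^] i"
      unfolding d(2) d'_def by (simp add: m_assoc[symmetric])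
    also have "\<dots> = b [^] (j mod p) \<otimes> ((b [^] p) [^] (j div p) \<otimes> d' \<otimes> x [^] i)"
      using nat_pow_mod_split[OF b, of j p] by (simp add: m_assoc)
    finally have "g = b [^] (j mod p) \<otimes> ((b [^] p) [^] (j div p) \<otimes> d' \<otimes> x [^] i)" .
    moreover have "b [^] p \<in> ?L" using b_pow_P m P_subset_C CL by auto
    then have "(b [^] p) [^] (j div p) \<in> ?L" by (rule subgroup_nat_pow_closed[OF L])
    then have "(b [^] p) [^] (j div p) \<otimes> d' \<otimes> x [^] i \<in> ?L"
      using CL d'C subgroup_nat_pow_closed[OF L xL, of i] subgroup.m_closed[OF L] by blast
    moreover have "b [^] (j mod p) \<in> ?S" using p_gt by simp
    ultimately show "g \<in> (\<lambda>(s, k). s \<otimes> k) ` (?S \<times> ?L)" by blast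
  qed
  then have "order G \<le> card ?S * card ?L"
    using finite_subset[OF subgroup.subset[OF L] fin] by (intro order_le_of_cover) auto
  also have "card ?S \<le> p" using card_image_le[of "{..<p}" "\<lambda>j. b [^] j"] by simp
  finally show ?thesis by (simp add: p2)
qed

text \<open>H has one coset besides itself, so x and y^(-1) share it.\<close>

lemma index_two_mult_mem:
  assumes H: "subgroup H G" and idx: "subgroup_index G H = 2"
    and xy: "x \<in> carrier G" "y \<in> carrier G" "x \<notin> H" "y \<notin> H"
  shows "x \<otimes> y \<in> H"
proof -
  note HC = subgroup.subset[OF H]
  have r: "H #> x \<in> rcosets H" "H #> inv y \<in> rcosets H" "H \<in> rcosets H"
    using rcosetsI[OF HC] xy subgroup.subgroup_in_rcosets[OF H is_group] by auto
  have ne: "H #> x \<noteq> H" "H #> inv y \<noteq> H"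
    using coset_join1[OF _ _ H] xy subgroup.m_inv_closed[OF H, of "inv y"] by auto
  have "H #> x = H #> inv y"
  proof (rule ccontr)
    assume "H #> x \<noteq> H #> inv y"
    then have "card {H, H #> x, H #> inv y} = 3" using ne by auto
    moreover have "finite (rcosets H)" using idx unfolding subgroup_index_def by (metis card.infinite zero_neq_numeral)
    ultimately have "3 \<le> card (rcosets H)" using r card_mono[of "rcosets H" "{H, H #> x, H #> inv y}"] by simp
    then show False using idx by (simp add: subgroup_index_def)
  qed
  then have "x \<in> H #> inv y" using rcos_self[OF xy(1) H] by simp
  then have "x \<otimes> inv (inv y) \<in> H" using subgroup.rcos_module_imp[OF H is_group, of "inv y" x] xy by simp
  then show ?thesis using xy by simp
qed

text \<open>
  Of the maximal subgroups containing \<open>a\<close> or \<open>ab\<close>, one centralizes \<open>c\<close> and is abelian; the other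
  one, generated by \<open>c\<close> and the element called \<open>x\<close> below, is the $\mathcal{A}_1$-subgroup.
\<close>

lemma unique_A1_index_two:
  assumes m: "m = 1"
  shows "\<exists>!H. A1_subgroup p H G \<and> subgroup_index G H = p"
proof -
  have p2: "p = 2" using m_one[OF m] by simp
  define t where "t = c [^] (2::nat)"
  have tP: "t \<in> P" and t1: "t \<noteq> \<one>" unfolding t_def using p2 c_pow_P_iff[of 2] c_pow_ne_one by auto
  note [simp] = P_carrier[OF tP]
  have cb: "c \<otimes> b = b \<otimes> c \<otimes> t" using m_one[OF m] by (simp add: t_def)
  have tt: "t \<otimes> t = \<one>" using P_pow[OF tP] p2 by (simp add: numeral_2_eq_2)
  obtain s where s: "s \<in> P" "c \<otimes> a = a \<otimes> c \<otimes> s" using c_commutator[OF a] by blast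
  have cab: "c \<otimes> (a \<otimes> b) = (a \<otimes> b) \<otimes> c \<otimes> (t \<otimes> s)" using c_mult_ab[OF s(1) tP s(2) cb] .
  \<comment> \<open>Since [c,ab] = t s with t^2 = 1, the value s = 1 makes a commute with c and
    gives [c,ab] = t, while s = t exchanges the two.\<close>
  obtain x y where xy: "{x, y} = {a, a \<otimes> b}" and cx: "c \<otimes> x = x \<otimes> c \<otimes> t" and cy: "c \<otimes> y = y \<otimes> c \<otimes> \<one>"
  proof (cases "s = \<one>")
    case True
    show thesis by (rule that[of "a \<otimes> b" a]) (use True cab s(2) in auto)
  next
    case False
    then have "s = t" using P_two_eq[OF p2 s(1) _ tP t1] by blast
    then show thesis using cab s(2) tt by (intro that[of a "a \<otimes> b"]) simp_all
  qed
  have xc [simp]: "x \<in> carrier G" "y \<in> carrier G" using xy a b m_closed by (metis insertCI insertE singletonD)+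
  have gens: "generate G {x, b} = carrier G" "generate G {y, b} = carrier G"
    using xy gen_ab gen_ab_b by (metis insertCI insertE singletonD)+
  let ?L = "generate G {c, x}" let ?M = "generate G {c, y}"
  have L: "subgroup ?L G" by (intro generate_is_subgroup) simp
  have A1L: "A1_subgroup p ?L G"
    using A1_subgroup_generate[OF prime ord c_carrier xc(1) P_central[OF tP] cx P_pow[OF tP] t1] .
  have fins: "finite K" if "subgroup K G" for K using finite_subset[OF subgroup.subset[OF that] fin] .
  have pos: "card K > 0" if "subgroup K G" for K
    using that fins subgroup.one_closed card_gt_0_iff by blast
  have idxL: "subgroup_index G ?L = p"
  proof -
    have "subgroup_index G ?L * card ?L \<le> 2 * card ?L"
      using order_le_two_generate[OF m xc(1) gens(1)] subgroup_index_mult_card[OF L] by simp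
    then have "subgroup_index G ?L \<le> 2" using pos[OF L] by simp
    moreover have "subgroup_index G ?L \<noteq> 1"
    proof
      assume "subgroup_index G ?L = 1"
      then have "card ?L = card (carrier G)" using subgroup_index_mult_card[OF L] by (simp add: order_def)
      then have "?L = carrier G" using card_subset_eq[OF fin subgroup.subset[OF L]] by blast
      then show False using generate_ne_carrier[OF c_carrier xc(1) tP cx] by simp
    qed
    moreover have "subgroup_index G ?L \<noteq> 0"
    proof
      assume "subgroup_index G ?L = 0"
      then have "order G = 0" using subgroup_index_mult_card[OF L] by simp
      then show False using fin order_gt_0_iff_finite by simp
    qed
    ultimately show ?thesis using p2 by simp
  qed
  have "H = ?L" if A1: "A1_subgroup p H G" and idx: "subgroup_index G H = p" for H
  proof -
    have H: "subgroup H G" using A1 by (simp add: A1_subgroup_def)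
    have NH: "N \<subseteq> H" and pow: "\<And>g. g \<in> carrier G \<Longrightarrow> g [^] p \<in> H"
      using prime_index_derived_subset[OF prime ord H idx] by blast+
    have cH: "c \<in> H" using NH N_eq c_C by blast
    have HG: "H \<noteq> carrier G" using A1_proper[OF A1] .
    have bH: "b \<notin> H"
    proof
      \<comment> \<open>For m = 1, b is itself b^(p^(m-1)). With n > 1 the element a^(p^(n-1)) is a
        power of a^p and lies in H too, so all three elements of the excluded configuration are
        present.\<close>
      assume bH: "b \<in> H"
      have "n \<ge> 2" using n_gt p2 by simp
      then have "p ^ (n - 1) = p * p ^ (n - 2)"
        by (metis One_nat_def Suc_diff_Suc Suc_le_lessD numeral_2_eq_2 power_Suc)
      then have "a [^] (p ^ (n - 1)) = (a [^] p) [^] (p ^ (n - 2))" by (simp add: nat_pow_pow)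
      then have "a [^] (p ^ (n - 1)) \<in> H" using subgroup_nat_pow_closed[OF H pow[OF a]] by simp
      then show False
        using A1_subgroup_omits_exponent_p_elements[OF A1 _ HG _ _ cH] NH P_subset_N bH m by auto
    qed
    have "a \<in> H \<or> a \<otimes> b \<in> H" using index_two_mult_mem[OF H _ a b _ bH] idx p2 by blast
    then have "x \<in> H \<or> y \<in> H" using xy by (metis insertCI insertE singletonD)
    \<comment> \<open>H has index 2 and <c,w> has index at most 2, so the inclusion is an
      equality.\<close>
    have gen_eq: "H = generate G {c, w}" if "w \<in> H" "w \<in> carrier G" "generate G {w, b} = carrier G" for w
    proof -
      have sub: "generate G {c, w} \<subseteq> H" using generate_subgroup_incl[OF _ H] cH that by simp
      have "2 * card H \<le> 2 * card (generate G {c, w})"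
        using order_le_two_generate[OF m that(2,3)] subgroup_index_mult_card[OF H] idx p2 by simp
      then show ?thesis using card_seteq[OF fins[OF H] sub] by simp
    qed
    have "y \<notin> H"
    proof
      assume "y \<in> H"
      then have eq: "H = ?M" using gen_eq gens by simp
      \<comment> \<open>As c and y commute, the normal form with trivial t makes every commutator of
        <c,y> trivial, so H would be abelian.\<close>
      have one: "central_elem \<one>" by (simp add: central_elem_def)
      obtain u v where uv: "u \<in> H" "v \<in> H" "u \<otimes> v \<noteq> v \<otimes> u"
        using A1_subgroup_two_generated[OF A1] by blast
      obtain k :: nat where "u \<otimes> v \<otimes> inv u \<otimes> inv v = \<one> [^] k"
        using normal_form_commutator[OF fin p_gt(1) c_carrier xc(2) one cy nat_pow_one, of u v] uv eq by blast
      then have "u \<otimes> v \<otimes> inv u \<otimes> inv v = \<one>" by simp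
      moreover have "u \<in> carrier G" "v \<in> carrier G" using uv subgroup.mem_carrier[OF H] by blast+
      ultimately have "u \<otimes> v = v \<otimes> u" by (metis inv_closed inv_inv inv_solve_right' l_one m_closed)
      then show False using uv by blast
    qed
    then show ?thesis using \<open>x \<in> H \<or> y \<in> H\<close> gen_eq gens by simp
  qed
  then show ?thesis using A1L idxL by blast
qed

lemma commutator_c_b: "m = 1 \<Longrightarrow> commutator G c b = c [^] (2::nat)"
proof -
  assume "m = 1"
  then have "b \<otimes> c \<otimes> commutator G c b = b \<otimes> c \<otimes> c [^] (2::nat)"
    using m_one(2) mult_commutator[OF c_carrier b] by simp
  then show ?thesis by (simp del: nat_pow_Suc)
qed

end

theorem theorem3p1:
  fixes G :: "('a, 'b) monoid_scheme" and p n m :: nat and a b c :: 'a and P :: "'a set"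
  defines "P \<equiv> frattini (G\<lparr>carrier := derived_subgroup G\<rparr>)"
    and "c \<equiv> commutator G a b"
  assumes "Factorial_Ring.prime p" and "finite_p_group p G"
    and "m \<ge> 1" and "n \<ge> m" and "p = 2 \<Longrightarrow> n > 1"
    and "lower_central_3 G \<subseteq> P"
    and "G\<lparr>carrier := P\<rparr> \<cong> integer_mod_group p"
    and "G Mod P \<cong> Mp p n m"
    and "a \<in> carrier G" and "b \<in> carrier G"
    and "generate (G Mod P) {P #>\<^bsub>G\<^esub> a, P #>\<^bsub>G\<^esub> b} = carrier (G Mod P)"
    and "satisfies_relations (G Mod P)
           (case_gen (P #>\<^bsub>G\<^esub> a) (P #>\<^bsub>G\<^esub> b) (P #>\<^bsub>G\<^esub> c)) (Mp_relations p n m)"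
  shows "(m = 1 \<longrightarrow>
            p = 2 \<and> commutator G c b = c [^]\<^bsub>G\<^esub> (2::nat) \<and>
            (\<exists>!H. A1_subgroup p H G \<and> subgroup_index G H = p)) \<and>
         (m \<ge> 2 \<longrightarrow> I_min p G = 2 \<and> min_A1_index p G = p ^ 2)"
proof -
  obtain e where e: "order G = p ^ e" and G: "group G"
    using assms(4) unfolding finite_p_group_def by blast
  interpret Mp_extension G p e n m a b c P
    using assms(3,5-) e G
    by (intro Mp_extension.intro Mp_extension_axioms.intro) (simp_all add: P_def c_def)
  show ?thesis
    using m_one(1) commutator_c_b unique_A1_index_two min_A1_index_eq I_min_eq by blast
qed

end
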